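(* Let $n\ge 2$ be an integer. As an identity of rational functions in the indeterminates $q,\rho,\tau$, $$A_n\bigl(2+q+q^{-1},\rho,\tau\bigr)=\left(\frac{(1+\rho q)(\tau+q)}{(1+q)^2}\right)^{n-1}\cdot\frac{\tau\rho\cdot\det\bigl(K^{\rho,\tau}_{i,j}(q)\bigr)_{1\le i,j\le n}}{(2-q-q^{-1})^{\frac{n(n-1)}{2}}},$$ where $$K^{\rho,\tau}_{i,j}(q)=\sum_{k=-n+1}^{n}(-1)^{k+1}\frac{q^k-q^{-k}}{q-q^{-1}}\binom{2j+k-3}{i-1}\left[\binom{n-2}{k+j-3}+\left(\frac{\rho+q}{1+\rho q}+\frac{1+\tau q}{\tau+q}\right)\binom{n-2}{k+j-2}+\frac{(\rho+q)(1+\tau q)}{(1+\rho q)(\tau+q)}\binom{n-2}{k+j-1}\right].$$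
   Context: An alternating sign matrix (ASM) of order $n$ is an $n\times n$ matrix with entries in $\{0,1,-1\}$ such that in each row and each column the nonzero entries alternate between $1$ and $-1$, beginning and ending with $1$ (so every row and column sums to $1$). The first row and the last row of an ASM each contain exactly one $1$ and no $-1$. Let $\mathrm{ASM}(n)$ be the set of all ASMs of order $n$. For $A\in\mathrm{ASM}(n)$ let $\mu(A)$ be the number of entries $-1$ in $A$, $f(A)$ the column index of the unique $1$ in the first row, and $\ell(A)$ the column index of the unique $1$ in the last row. Define $$A_n(z,\rho,\tau)=\sum_{A\in\mathrm{ASM}(n)}z^{\mu(A)}\rho^{f(A)}\tau^{\ell(A)}.$$ Binomial coefficients: for an integer $N\ge 0$, $\binom{N}{m}=0$ if $m<0$ or $m>N$. (A binomial coefficient $\binom{2j+k-3}{i-1}$ with negative upper entry occurs only multiplied by zero.) *)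

theory Defs
  imports
    "HOL-Computational_Algebra.Polynomial_Factorial"
    "Jordan_Normal_Form.Determinant"
begin

definition alternating_signs :: "int list \<Rightarrow> bool" where
  "alternating_signs xs \<longleftrightarrow>
     (let ys = filter (\<lambda>x. x \<noteq> 0) xs
      in set ys \<subseteq> {1, -1} \<and> ys \<noteq> [] \<and> hd ys = 1 \<and> last ys = 1 \<and> successively (\<noteq>) ys)"

definition ASM :: "nat \<Rightarrow> int mat set" where
  "ASM n = {A \<in> carrier_mat n n.
     (\<forall>i<n. alternating_signs (list_of_vec (row A i))) \<and>
     (\<forall>j<n. alternating_signs (list_of_vec (col A j)))}"

definition asm_mu :: "int mat \<Rightarrow> nat" where
  "asm_mu A = card {(i, j). i < dim_row A \<and> j < dim_col A \<and> A $$ (i, j) = -1}"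

text \<open>Column indices are counted from 1 as in the mathematical convention, whereas
  matrix entries are indexed from 0.\<close>

definition asm_first :: "int mat \<Rightarrow> nat" where
  "asm_first A = (THE j. 1 \<le> j \<and> j \<le> dim_col A \<and> A $$ (0, j - 1) = 1)"

definition asm_last :: "int mat \<Rightarrow> nat" where
  "asm_last A = (THE j. 1 \<le> j \<and> j \<le> dim_col A \<and> A $$ (dim_row A - 1, j - 1) = 1)"

definition asm_gf :: "nat \<Rightarrow> 'a::field \<Rightarrow> 'a \<Rightarrow> 'a \<Rightarrow> 'a" where
  "asm_gf n z \<rho> \<tau> = (\<Sum>A\<in>ASM n. z ^ asm_mu A * \<rho> ^ asm_first A * \<tau> ^ asm_last A)"

text \<open>Binomial coefficients with integer arguments. For \<open>N < 0\<close> the value is 0; such terms only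
  ever occur multiplied by zero below.\<close>

definition int_binom :: "int \<Rightarrow> int \<Rightarrow> nat" where
  "int_binom N m = (if 0 \<le> m \<and> m \<le> N then nat N choose nat m else 0)"

definition K_entry :: "nat \<Rightarrow> 'a::field \<Rightarrow> 'a \<Rightarrow> 'a \<Rightarrow> int \<Rightarrow> int \<Rightarrow> 'a" where
  "K_entry n q \<rho> \<tau> i j =
     (\<Sum>k\<in>{- int n + 1..int n}.
        (-1) powi (k + 1) * ((q powi k - q powi (-k)) / (q - inverse q))
        * of_nat (int_binom (2 * j + k - 3) (i - 1))
        * (of_nat (int_binom (int n - 2) (k + j - 3))
           + ((\<rho> + q) / (1 + \<rho> * q) + (1 + \<tau> * q) / (\<tau> + q))
             * of_nat (int_binom (int n - 2) (k + j - 2))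
           + ((\<rho> + q) * (1 + \<tau> * q)) / ((1 + \<rho> * q) * (\<tau> + q))
             * of_nat (int_binom (int n - 2) (k + j - 1))))"

text \<open>The entries are shifted because matrices are indexed from 0.\<close>

definition K_mat :: "nat \<Rightarrow> 'a::field \<Rightarrow> 'a \<Rightarrow> 'a \<Rightarrow> 'a mat" where
  "K_mat n q \<rho> \<tau> = mat n n (\<lambda>(i, j). K_entry n q \<rho> \<tau> (int i + 1) (int j + 1))"

text \<open>The field of rational functions in three indeterminates over \<open>'a\<close> is the fraction field of
  the iterated polynomial ring: \<open>q\<close>, \<open>\<rho>\<close>, \<open>\<tau>\<close> are the variables of the innermost, middle and
  outermost polynomial layer.\<close>

type_synonym 'a ratfun3 = "'a poly poly poly fract"

definition q_var :: "'a::field_char_0 ratfun3" where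
  "q_var = to_fract [:[:[:0, 1:]:]:]"

definition rho_var :: "'a::field_char_0 ratfun3" where
  "rho_var = to_fract [:[:0, 1:]:]"

definition tau_var :: "'a::field_char_0 ratfun3" where
  "tau_var = to_fract [:0, 1:]"

end

theory Submission
  imports Defs
begin

text \<open>
An alternating sign matrix is a state of the six-vertex model on a square with domain wall boundary
conditions: the partial sums \<open>h\<close> of a row and \<open>v\<close> of a column take the values 0 and 1 only, and an entry
is the common jump of the two. Attach a parameter \<open>a\<close> to each row and \<open>s\<close> to each column. A zero entry
has weight \<open>q s - a\<close> if \<open>h = v\<close> and \<open>q a - s\<close> otherwise, an entry 1 has weight 1, and an entry -1 has
weight \<open>(q\<^sup>2 - 1)\<^sup>2 a s / q\<close>. If all parameters are 1, zeros have weight \<open>q - 1\<close>, and after normalisation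
every -1 counts \<open>2 + q + 1/q\<close>. Changing the parameter of the first row to \<open>(\<rho> + q) / (1 + \<rho> q)\<close> makes the
ratio of its two weights of zeros equal to \<open>\<rho>\<close>, so that the weight records the position of its 1;
\<open>(1 + \<tau> q) / (\<tau> + q)\<close> does the same in the last row (\<open>dwbc_boundary_rows\<close>).

The partition function \<open>Z\<close> with general parameters is computed by the method of Izergin and Korepin. By
the Yang-Baxter equation (\<open>row_transfer_yang_baxter\<close>) it is symmetric in the row parameters. It is
a polynomial of degree less than \<open>n\<close> in the first column parameter \<open>s\<close>. At \<open>s = a / q\<close> a zero in the corner has
weight 0, which freezes the first row and the first column and leaves a partition function of size
\<open>n - 1\<close>. These properties determine \<open>Z\<close> by interpolation. They are shared by
\<open>det (f\<^sub>j(s\<^sub>i)) / \<Prod>\<^bsub>l<i\<^esub> (s\<^sub>i - s\<^sub>l)\<close> up to powers of \<open>q\<close> and sign, where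
\<open>f\<^sub>j(s) = ((-s q)\<^sup>j P(-s/q) - (-s/q)\<^sup>j P(-s q)) / ((q - 1/q) s)\<close> for \<open>j = 0, \<dots>, n - 1\<close> and
\<open>P(x) = \<Prod>\<^sub>i (x + a\<^sub>i)\<close>; at \<open>s\<^sub>1 = a\<^sub>1 / q\<close> an elementary column operation performs the reduction
(\<open>det_dw_mat_corner\<close>, \<open>det_dw_mat_eq_dwbc_generic\<close>).

To set all column parameters to 1, the Vandermonde product is split off by Newton interpolation. What
remains is the determinant of the divided differences of the \<open>f\<^sub>j\<close>, and since both sides are polynomials in
all parameters, the formula extends to coinciding parameters (\<open>det_dw_newton_eq_dwbc\<close>). At 1 the divided
differences are Taylor coefficients, that is, sums of coefficients of \<open>f\<^sub>j\<close> times binomial coefficients. The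
coefficients of \<open>f\<^sub>j\<close> are up to sign \<open>q\<close>-numbers times the coefficients of \<open>P\<close>, and for
\<open>P(x) = (x + 1)\<^sup>n\<^sup>-\<^sup>2 (x + \<alpha>) (x + \<beta>)\<close>, with \<open>\<alpha>\<close> and \<open>\<beta>\<close> the parameters of the first and the last row, the
result is the matrix \<open>K\<close> (\<open>K_mat_eq_dw_newton\<close>).
\<close>

section \<open>The six-vertex model and the Yang-Baxter equation\<close>

text \<open>One row of the six-vertex model. The Boolean \<open>h\<close> is the partial sum of the row entries to the left
of the current column, the list \<open>vs\<close> holds the partial sums of the columns above the row, and a
nonzero entry flips both. The weighted sum over all rows is written in continuation style: \<open>F\<close> is
the weight of everything below, as a function of the new column sums, so that stacking rows is
composition of functionals and needs no explicit sum over intermediate states. A row must end with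
sum one, whence the value 0 for \<open>h = False\<close> at the end.

The weights satisfy \<open>A\<^sup>2 + B\<^sup>2 - C = - (q + 1/q) A B\<close>, where \<open>A = q s - a\<close>, \<open>B = q a - s\<close>, and \<open>C\<close> is the
product of the weights of the entries 1 and -1. The left-hand side divided by \<open>A B\<close> does not depend
on the spectral parameters, which is what the Yang-Baxter equation requires. Giving the entry 1
weight 1, rather than sharing \<open>C\<close> symmetrically, keeps the degree in the column parameter low.\<close>

fun row_transfer ::
  "'a::field \<Rightarrow> 'a \<Rightarrow> bool \<Rightarrow> 'a list \<Rightarrow> bool list \<Rightarrow> (bool list \<Rightarrow> 'a) \<Rightarrow> 'a" where
  "row_transfer q a h [] vs F = (if h then F [] else 0)"
| "row_transfer q a h (s # ss) [] F = 0"
| "row_transfer q a h (s # ss) (v # vs) F =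
     (if h = v
      then (q * s - a) * row_transfer q a h ss vs (\<lambda>u. F (v # u))
         + (if h then (q\<^sup>2 - 1)\<^sup>2 * a * s / q else 1)
           * row_transfer q a (\<not> h) ss vs (\<lambda>u. F ((\<not> v) # u))
      else (q * a - s) * row_transfer q a h ss vs (\<lambda>u. F (v # u)))"

text \<open>The partition function with domain wall boundary conditions, started from arbitrary column sums
\<open>vs\<close>: below the last row all columns must have sum one.\<close>

fun dwbc :: "'a::field \<Rightarrow> 'a list \<Rightarrow> 'a list \<Rightarrow> bool list \<Rightarrow> 'a" where
  "dwbc q [] ss vs = (if \<forall>v\<in>set vs. v then 1 else 0)"
| "dwbc q (a # as) ss vs = row_transfer q a False ss vs (dwbc q as ss)"

lemma row_transfer_add:
  "row_transfer q a h ss vs (\<lambda>u. F u + G u) = row_transfer q a h ss vs F + row_transfer q a h ss vs G"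
proof (induction q a h ss vs F arbitrary: G rule: row_transfer.induct)
  case (3 q a h s ss v vs F)
  show ?case 
    using 3(1)[of "\<lambda>u. G (v # u)"] 3(2)[of "\<lambda>u. G ((\<not> v) # u)"] 3(3)[of "\<lambda>u. G (v # u)"]
    by (cases "h = v") (simp_all only: row_transfer.simps if_True if_False distrib_left simp_thms ac_simps)
qed auto

lemma row_transfer_scale:
  "row_transfer q a h ss vs (\<lambda>u. c * F u) = c * row_transfer q a h ss vs F"
  by (induction q a h ss vs F rule: row_transfer.induct) (auto simp: algebra_simps)

text \<open>The action of two consecutive rows on one column. The sums over both rows are merged into a single
functional \<open>T\<close>, indexed by the two row sums and the resulting column sum.\<close>

lemma double_row_step:
  fixes q x y s :: "'a::field" and F :: "bool list \<Rightarrow> 'a"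
  fixes ss vs h k v
  defines "C \<equiv> \<lambda>x h. if h then (q\<^sup>2 - 1)\<^sup>2 * x * s / q else 1"
    and "T \<equiv> \<lambda>h k v. row_transfer q x h ss vs (\<lambda>u. row_transfer q y k ss u (\<lambda>u. F (v # u)))"
  shows "row_transfer q x h (s # ss) (v # vs) (\<lambda>u. row_transfer q y k (s # ss) u F) =
    (if h = v
     then (q * s - x) * (if k = v then (q * s - y) * T h k v + C y k * T h (\<not> k) (\<not> v)
                         else (q * y - s) * T h k v)
       + C x h * (if k = v then (q * y - s) * T (\<not> h) k (\<not> v)
                  else (q * s - y) * T (\<not> h) k (\<not> v) + C y k * T (\<not> h) (\<not> k) v)
     else (q * x - s) * (if k = v then (q * s - y) * T h k v + C y k * T h (\<not> k) (\<not> v)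
                         else (q * y - s) * T h k v))"
  unfolding C_def T_def
  by (cases h; cases k; cases v;
      simp add: row_transfer_add row_transfer_scale del: times_divide_eq_left times_divide_eq_right)

text \<open>The Yang-Baxter equation, already carried through the whole double row. Exchanging two adjacent rows
costs a conjugation by a matrix that acts on the pair \<open>(h, k)\<close> of row sums; it is a multiple of the
identity on equal sums and mixes the two unequal pairs. In the induction on the number of columns the
matrix is pushed through a single column, which is a finite check over the eight values of \<open>h\<close>, \<open>k\<close>,
\<open>v\<close>. At the right end both rows have sum one, where the matrix is the scalar \<open>D\<close>.\<close>

lemma row_transfer_yang_baxter:
  fixes q a b :: "'a::field"
  assumes q: "q \<noteq> 0" and D: "D = q\<^sup>2 * a - b"
  shows "D * row_transfer q b h ss vs (\<lambda>u. row_transfer q a k ss u F) =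
     (if h = k then D else (q\<^sup>2 - 1) * (if h then b else a))
       * row_transfer q a h ss vs (\<lambda>u. row_transfer q b k ss u F)
   + (if h = k then 0 else q * (b - a))
       * row_transfer q a k ss vs (\<lambda>u. row_transfer q b h ss u F)"
proof (induction ss arbitrary: h k vs F)
  case Nil
  then show ?case by (auto simp: algebra_simps)
next
  case (Cons s ss)
  show ?case
  proof (cases vs)
    case Nil
    then show ?thesis by simp
  next
    case (Cons v ws)
    \<comment> \<open>Writing the column parameter as a multiple of \<open>q\<close> makes all weights polynomial.\<close>
    define s0 where "s0 = s / q"
    have s: "s = q * s0" using q by (simp add: s0_def)
    have C: "(q\<^sup>2 - 1)\<^sup>2 * x * (q * s0) / q = (q\<^sup>2 - 1)\<^sup>2 * x * s0" for x
      using q by simp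
    define G where "G = (\<lambda>x y h k v. row_transfer q x h ss ws (\<lambda>u. row_transfer q y k ss u (\<lambda>u. F (v # u))))"
    have fold_G: "row_transfer q x h ss ws (\<lambda>u. row_transfer q y k ss u (\<lambda>u. F (v # u))) = G x y h k v"
      for x y h k v by (simp add: G_def)
    have IH: "D * G b a h k v = (if h = k then D else (q\<^sup>2 - 1) * (if h then b else a)) * G a b h k v
        + (if h = k then 0 else q * (b - a)) * G a b k h v" for h k v
      unfolding G_def by (rule Cons.IH)
    \<comment> \<open>The factor \<open>D\<close> is moved onto each of the functionals \<open>G b a\<close>, where the induction hypothesis
      trades it for \<open>G a b\<close>; what remains is an identity of polynomials in the parameters.\<close>
    note push = distrib_left mult.left_commute[of D]
    show ?thesis
      unfolding Cons s double_row_step C fold_G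
      by (cases h; cases k; cases v; simp only: simp_thms if_True if_False push IH;
          simp only: simp_thms if_True if_False mult_zero_left mult_zero_right add_0_right;
          simp only: D; simp add: algebra_simps power2_eq_square)
  qed
qed

section \<open>Symmetry, degree and reduction of the partition function\<close>

lemma dwbc_Cons_fun: "dwbc q (a # as) ss = (\<lambda>vs. row_transfer q a False ss vs (dwbc q as ss))"
  by (rule ext) simp

lemma dwbc_swap_rows:
  assumes "q \<noteq> 0" and "q\<^sup>2 * a \<noteq> b"
  shows "dwbc q (a # b # as) ss vs = dwbc q (b # a # as) ss vs"
  using row_transfer_yang_baxter[OF assms(1) refl, of a b False ss vs False "dwbc q as ss"] assms(2)
  by (simp add: dwbc_Cons_fun)

text \<open>Only the exchange of a row with the ones above it is needed. The hypothesis keeps the scalar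
\<open>D\<close> of the Yang-Baxter equation nonzero.\<close>

lemma dwbc_row_to_front:
  assumes "q \<noteq> 0" and "\<And>b. b \<in> set xs \<Longrightarrow> q\<^sup>2 * a \<noteq> b"
  shows "dwbc q (xs @ a # ys) ss vs = dwbc q (a # xs @ ys) ss vs"
  using assms(2)
proof (induction xs arbitrary: vs)
  case (Cons x xs)
  have "dwbc q ((x # xs) @ a # ys) ss vs = row_transfer q x False ss vs (dwbc q (xs @ a # ys) ss)"
    by simp
  also have "dwbc q (xs @ a # ys) ss = dwbc q (a # xs @ ys) ss"
    using Cons by (intro ext) auto
  also have "row_transfer q x False ss vs (dwbc q (a # xs @ ys) ss) = dwbc q (x # a # xs @ ys) ss vs"
    by simp
  also have "\<dots> = dwbc q (a # x # xs @ ys) ss vs"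
    by (rule dwbc_swap_rows[symmetric]) (use assms(1) Cons.prems in auto)
  finally show ?case by simp
qed simp

text \<open>An entry -1 needs an earlier 1 in its row, so it cannot occur in the first column; and a 1 is
impossible below partial sum 1. So the column is frozen and splits off as a factor.\<close>

lemma dwbc_finished_column:
  "dwbc q as (s # ss) (True # vs) = (\<Prod>a\<leftarrow>as. q * a - s) * dwbc q as ss vs"
proof (induction as arbitrary: vs)
  case (Cons a as)
  have "(\<lambda>u. dwbc q as (s # ss) (True # u)) = (\<lambda>u. (\<Prod>a\<leftarrow>as. q * a - s) * dwbc q as ss u)"
    using Cons by auto
  then show ?case by (simp add: row_transfer_scale)
qed simp

lemma row_transfer_finished_row:
  assumes "length ss = n"
  shows "row_transfer q a True ss (replicate n False) F = (\<Prod>s\<leftarrow>ss. q * a - s) * F (replicate n False)"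
  using assms by (induction ss arbitrary: n F) auto

text \<open>At \<open>s = a / q\<close> the weight of a zero in the top left corner vanishes, so the corner entry is 1. This
freezes the rest of the first row and of the first column, and a partition function with one row and
one column fewer remains.\<close>

lemma dwbc_frozen_corner:
  assumes "q \<noteq> 0" and "length ss = n"
  shows "dwbc q (a # as) (a / q # ss) (replicate (Suc n) False) =
    (\<Prod>b\<leftarrow>as. q * b - a / q) * (\<Prod>s\<leftarrow>ss. q * a - s) * dwbc q as ss (replicate n False)"
  using assms by (simp add: dwbc_finished_column row_transfer_finished_row)

text \<open>Polynomial functions with a degree bound, for the interpolation argument. The partition function is
not given as a polynomial, only as a function of its parameters.\<close>

definition polynomial_le :: "nat \<Rightarrow> ('a::comm_ring_1 \<Rightarrow> 'a) \<Rightarrow> bool" where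
  "polynomial_le d f \<longleftrightarrow> (\<exists>p. degree p \<le> d \<and> (\<forall>x. f x = poly p x))"

lemma polynomial_leI: "degree p \<le> d \<Longrightarrow> (\<And>x. f x = poly p x) \<Longrightarrow> polynomial_le d f"
  by (auto simp: polynomial_le_def)

lemma polynomial_le_const: "polynomial_le d (\<lambda>x. c)"
  by (rule polynomial_leI[of "[:c:]"]) auto

lemma polynomial_le_add:
  assumes "polynomial_le d f" "polynomial_le d g"
  shows "polynomial_le d (\<lambda>x. f x + g x)"
proof -
  from assms obtain p r where "degree p \<le> d" "\<forall>x. f x = poly p x" "degree r \<le> d" "\<forall>x. g x = poly r x"
    by (auto simp: polynomial_le_def)
  then show ?thesis by (intro polynomial_leI[of "p + r"]) (auto intro: degree_add_le)
qed

lemma polynomial_le_mult: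
  assumes "polynomial_le d f" "polynomial_le e g"
  shows "polynomial_le (d + e) (\<lambda>x. f x * g x)"
proof -
  from assms obtain p r where "degree p \<le> d" "\<forall>x. f x = poly p x" "degree r \<le> e" "\<forall>x. g x = poly r x"
    by (auto simp: polynomial_le_def)
  then show ?thesis
    by (intro polynomial_leI[of "p * r"]) (auto intro: order.trans[OF degree_mult_le])
qed

lemma polynomial_le_mono: "polynomial_le d f \<Longrightarrow> d \<le> e \<Longrightarrow> polynomial_le e f"
  unfolding polynomial_le_def by (meson order.trans)

lemma polynomial_le_cmult: "polynomial_le d f \<Longrightarrow> polynomial_le d (\<lambda>x. c * f x)"
  using polynomial_le_mult[OF polynomial_le_const[of 0 c]] by auto

lemma polynomial_le_sum:
  "(\<And>i. i \<in> I \<Longrightarrow> polynomial_le d (f i)) \<Longrightarrow> polynomial_le d (\<lambda>x. \<Sum>i\<in>I. f i x)"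
  by (induction I rule: infinite_finite_induct) (auto intro: polynomial_le_const polynomial_le_add)

lemma polynomial_le_power: "polynomial_le d (\<lambda>x. x ^ d)"
  by (rule polynomial_leI[of "monom 1 d"]) (auto simp: degree_monom_le poly_monom)

lemma polynomial_le_linear: "polynomial_le 1 (\<lambda>x. c * x + d)"
  by (rule polynomial_leI[of "[:d, c:]"]) auto

lemma polynomial_le_prod_list:
  "(\<And>y. y \<in> set ys \<Longrightarrow> polynomial_le 1 (f y)) \<Longrightarrow> polynomial_le (length ys) (\<lambda>x. \<Prod>y\<leftarrow>ys. f y x)"
proof (induction ys)
  case (Cons y ys)
  then show ?case using polynomial_le_mult[of 1 "f y" "length ys"] by simp
qed (auto intro: polynomial_le_const)

lemma polynomial_le_row_transfer:
  assumes "\<And>u. polynomial_le d (\<lambda>x. F x u)"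
  shows "polynomial_le d (\<lambda>x. row_transfer q a h ss vs (F x))"
  using assms
proof (induction ss arbitrary: h vs F)
  case (Cons s ss)
  show ?case
  proof (cases vs)
    case (Cons v ws)
    then show ?thesis using Cons.prems
      by (cases "h = v") (auto simp del: if_split times_divide_eq_left times_divide_eq_right
          intro!: polynomial_le_add polynomial_le_cmult Cons.IH)
  qed (auto intro: polynomial_le_const)
next
  case Nil
  then show ?case by (cases h) (auto intro: polynomial_le_const)
qed

text \<open>The first column contains exactly one entry 1 and no -1, so at most \<open>n - 1\<close> of its entries have a
weight that depends on \<open>s\<close>, each linearly.\<close>

lemma dwbc_degree_first_column:
  "polynomial_le (length as - 1) (\<lambda>s. dwbc q as (s # ss) (False # vs))"
proof (induction as arbitrary: vs)
  case (Cons a as)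
  have "polynomial_le (length as) (\<lambda>s. (q * s - a) * row_transfer q a False ss vs (\<lambda>u. dwbc q as (s # ss) (False # u)))"
  proof (cases as)
    case Nil
    then show ?thesis using row_transfer_scale[of q a False ss vs 0 "\<lambda>_. 0"]
      by (auto intro: polynomial_le_const)
  next
    case (Cons b bs)
    then show ?thesis
      using polynomial_le_mult[OF polynomial_le_linear[of q "-a"] polynomial_le_row_transfer[OF Cons.IH]]
      by simp
  qed
  moreover have "polynomial_le (length as) (\<lambda>s. row_transfer q a True ss vs (\<lambda>u. dwbc q as (s # ss) (True # u)))"
  proof (rule polynomial_le_row_transfer)
    fix u
    have "polynomial_le (length as) (\<lambda>s. \<Prod>a\<leftarrow>as. q * a - s)"
      using polynomial_le_linear[of "-1"] by (intro polynomial_le_prod_list) (auto simp: algebra_simps)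
    then show "polynomial_le (length as) (\<lambda>s. dwbc q as (s # ss) (True # u))"
      unfolding dwbc_finished_column
      by (subst mult.commute) (rule polynomial_le_cmult)
  qed
  ultimately show ?case by (auto intro: polynomial_le_add)
qed (auto intro: polynomial_le_const)

lemma polynomial_le_eqI:
  fixes f g :: "'a::idom \<Rightarrow> 'a"
  assumes "polynomial_le d f" "polynomial_le d g" "finite S" "card S > d" "\<And>x. x \<in> S \<Longrightarrow> f x = g x"
  shows "f x = g x"
proof -
  from assms obtain p r where p: "degree p \<le> d" "\<And>x. f x = poly p x" and r: "degree r \<le> d" "\<And>x. g x = poly r x"
    by (auto simp: polynomial_le_def)
  have "degree (p - r) \<le> d" using p(1) r(1) by (rule degree_diff_le)
  have "p - r = 0"
  proof (rule ccontr)
    assume nz: "p - r \<noteq> 0"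
    have "card S \<le> card {x. poly (p - r) x = 0}"
      using poly_roots_finite[OF nz] assms(5) p r by (intro card_mono) auto
    also have "\<dots> \<le> degree (p - r)" using nz by (rule card_poly_roots_bound)
    finally show False using \<open>degree (p - r) \<le> d\<close> assms(4) by simp
  qed
  then show ?thesis using p r by simp
qed

section \<open>The determinant and its reduction\<close>

text \<open>The row parameters enter the determinant only through this polynomial, whose coefficients are their
elementary symmetric functions.\<close>

definition row_poly :: "'a::comm_ring_1 list \<Rightarrow> 'a poly" where
  "row_poly as = (\<Prod>a\<leftarrow>as. [:a, 1:])"

lemma row_poly_simps [simp]:
  "row_poly [] = 1" "row_poly (a # as) = [:a, 1:] * row_poly as"
  "row_poly (xs @ ys) = row_poly xs * row_poly ys"
  by (simp_all add: row_poly_def)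

lemma degree_row_poly: "degree (row_poly (as :: 'a::idom list)) \<le> length as"
proof (induction as)
  case (Cons a as)
  have "degree ([:a, 1:] * row_poly as) \<le> degree [:a, 1:] + degree (row_poly as)"
    by (rule degree_mult_le)
  then show ?case using Cons by (simp del: mult_pCons_left)
qed simp

lemma poly_row_poly: "poly (row_poly as) x = (\<Prod>a\<leftarrow>as. a + x)"
  by (induction as) (auto simp: algebra_simps)

text \<open>The quotient is the \<open>q\<close>-number \<open>[m - j]\<close>. Together with \<open>dw_fun\<close> this is the expansion of
\<open>((-s q)\<^sup>j P(-s/q) - (-s/q)\<^sup>j P(-s q)) / ((q - 1/q) s)\<close> in powers of \<open>s\<close>, where \<open>P\<close> is \<open>row_poly as\<close>;
see \<open>dw_fun_closed_form\<close>. The truncated exponent \<open>m + j - 1\<close> for \<open>m = j = 0\<close> is harmless since \<open>[0] = 0\<close>.\<close>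

definition dw_coeff :: "'a::field \<Rightarrow> 'a list \<Rightarrow> nat \<Rightarrow> nat \<Rightarrow> 'a" where
  "dw_coeff q as j m = (-1) ^ (m + j + 1)
     * ((q powi (int m - int j) - q powi (- (int m - int j))) / (q - inverse q)) * coeff (row_poly as) m"

definition dw_fun :: "'a::field \<Rightarrow> 'a list \<Rightarrow> nat \<Rightarrow> 'a \<Rightarrow> 'a" where
  "dw_fun q as j s = (\<Sum>m\<le>length as. dw_coeff q as j m * s ^ (m + j - 1))"

definition dw_mat :: "'a::field \<Rightarrow> 'a list \<Rightarrow> 'a list \<Rightarrow> 'a mat" where
  "dw_mat q as ss = mat (length ss) (length ss) (\<lambda>(i, j). dw_fun q as j (ss ! i))"

lemma poly_row_poly_sum:
  "poly (row_poly (as :: 'a::idom list)) x = (\<Sum>m\<le>length as. coeff (row_poly as) m * x ^ m)"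
  unfolding poly_altdef
  by (rule sum.mono_neutral_left) (use degree_row_poly[of as] in \<open>auto simp: coeff_eq_0\<close>)

lemma dw_fun_closed_form:
  assumes q: "q \<noteq> 0"
  shows "s * dw_fun q as j s = ((- s * q) ^ j * poly (row_poly as) (- s / q)
      - (- s / q) ^ j * poly (row_poly as) (- s * q)) / (q - inverse q)"
proof -
  have "s * (dw_coeff q as j m * s ^ (m + j - 1)) = 
     ((- s * q) ^ j * (coeff (row_poly as) m * (- s / q) ^ m)
      - (- s / q) ^ j * (coeff (row_poly as) m * (- s * q) ^ m)) / (q - inverse q)" for m
  proof (cases "m + j = 0")
    case True
    then show ?thesis by (simp add: dw_coeff_def)
  next
    case False
    then have s: "s * s ^ (m + j - 1) = s ^ (m + j)" by (simp flip: power_Suc)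
    have pw: "q powi (int m - int j) = q ^ m / q ^ j" "q powi (- (int m - int j)) = q ^ j / q ^ m"
      using q by (simp_all add: power_int_diff)
    have "s * (dw_coeff q as j m * s ^ (m + j - 1)) = dw_coeff q as j m * s ^ (m + j)"
      using s by (metis mult.left_commute)
    also have "\<dots> = ((- s * q) ^ j * (coeff (row_poly as) m * (- s / q) ^ m)
      - (- s / q) ^ j * (coeff (row_poly as) m * (- s * q) ^ m)) / (q - inverse q)"
      unfolding dw_coeff_def pw
      unfolding power_minus[of s] minus_mult_left[symmetric] power_minus[of "s * q"]
         power_minus[of "s / q"] minus_divide_left[symmetric]
      by (simp add: power_mult_distrib power_divide power_add algebra_simps diff_divide_distrib)
    finally show ?thesis .
  qed
  then show ?thesis
    unfolding dw_fun_def poly_row_poly_sum sum_distrib_left 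
    by (simp flip: sum_subtractf sum_divide_distrib)
qed

text \<open>In the closed form, adding \<open>a\<close> times the function with index \<open>j\<close> to the one with index \<open>j + 1\<close>
multiplies \<open>(-s q)\<^sup>j\<close> by \<open>a - s q\<close> and \<open>(-s/q)\<^sup>j\<close> by \<open>a - s/q\<close>. Removing the linear factor of \<open>a\<close> from the
polynomial contributes the respective other factor, so the product of both comes out.\<close>

lemma dw_fun_Cons:
  assumes q: "q \<noteq> 0" and s: "s \<noteq> 0"
  shows "dw_fun q (a # as) (Suc j) s + a * dw_fun q (a # as) j s
    = (a - s * q) * (a - s / q) * dw_fun q as j s"
proof -
  have "s * (dw_fun q (a # as) (Suc j) s + a * dw_fun q (a # as) j s) 
    = s * dw_fun q (a # as) (Suc j) s + a * (s * dw_fun q (a # as) j s)"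
    by (simp add: algebra_simps)
  also have "\<dots> = (a - s * q) * (a - s / q) * (s * dw_fun q as j s)"
    unfolding dw_fun_closed_form[OF q]
    by (simp add: diff_divide_distrib add_divide_distrib algebra_simps)
  also have "\<dots> = s * ((a - s * q) * (a - s / q) * dw_fun q as j s)"
    by (rule mult.left_commute)
  finally show ?thesis by (rule iffD1[OF mult_left_cancel[OF s]])
qed

text \<open>At \<open>s = a / q\<close> the second term of the closed form vanishes.\<close>

lemma dw_fun_corner:
  assumes q: "q \<noteq> 0" "q\<^sup>2 \<noteq> 1" and a: "a \<noteq> 0"
  shows "dw_fun q (a # as) 0 (a / q) = poly (row_poly as) (- (a / q) / q)"
proof -
  have n: "q - inverse q \<noteq> 0" using q by (simp add: field_simps power2_eq_square)
  have "a / q * dw_fun q (a # as) 0 (a / q) 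
     = (a - a / q / q) * poly (row_poly as) (- (a / q) / q) / (q - inverse q)"
    unfolding dw_fun_closed_form[OF q(1)] using q by (simp add: algebra_simps)
  also have "(a - a / q / q) = a / q * (q - inverse q)" using q by (simp add: field_simps)
  finally show ?thesis using n a q by simp
qed

lemma dw_fun_degree: "polynomial_le (length as + j - 1) (dw_fun q as j)"
  unfolding dw_fun_def
  by (intro polynomial_le_sum polynomial_le_cmult polynomial_le_mono[OF polynomial_le_power]) auto

lemma det_scale_rows:
  "det (mat n n (\<lambda>(i, j). c i * f i j)) = (\<Prod>i<n. c i) * det (mat n n (\<lambda>(i, j). f i j))"
  (is "det ?A = _ * det ?B")
proof -
  have "(\<Prod>i = 0..<n. ?A $$ (i, p i)) = (\<Prod>i<n. c i) * (\<Prod>i = 0..<n. ?B $$ (i, p i))"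
    if p: "p permutes {0..<n}" for p
  proof -
    have "(\<Prod>i = 0..<n. ?A $$ (i, p i)) = (\<Prod>i = 0..<n. c i * f i (p i))"
      using permutes_in_image[OF p] by (intro prod.cong) auto
    also have "\<dots> = (\<Prod>i<n. c i) * (\<Prod>i = 0..<n. f i (p i))"
      by (simp add: prod.distrib atLeast0LessThan)
    also have "(\<Prod>i = 0..<n. f i (p i)) = (\<Prod>i = 0..<n. ?B $$ (i, p i))"
      using permutes_in_image[OF p] by (intro prod.cong) auto
    finally show ?thesis .
  qed
  then show ?thesis
    by (subst (1 2) det_def'[of _ n]) (auto simp: sum_distrib_left algebra_simps intro!: sum.cong)
qed

text \<open>The column operation is multiplication by the unipotent matrix \<open>U\<close>.\<close>

lemma det_add_previous_columns:
  "det (mat (Suc n) (Suc n) (\<lambda>(i, j). f i j)) =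
   det (mat (Suc n) (Suc n) (\<lambda>(i, j). case j of 0 \<Rightarrow> f i 0 | Suc k \<Rightarrow> f i (Suc k) + a * f i k))"
  (is "det ?A = det ?B")
proof -
  define U where "U = mat (Suc n) (Suc n) (\<lambda>(k, j). if k = j then 1 else if j = Suc k then a else 0)"
  have U: "U \<in> carrier_mat (Suc n) (Suc n)" by (simp add: U_def)
  have "det U = prod_list (diag_mat U)"
    by (rule det_upper_triangular[OF _ U]) (auto simp: upper_triangular_def U_def)
  also have "diag_mat U = map (\<lambda>_. 1) [0..<Suc n]"
    unfolding diag_mat_def using U by (intro map_cong) (auto simp: U_def)
  finally have "det U = 1" by (simp add: map_replicate_const)
  moreover have "?B = ?A * U"
  proof (rule eq_matI)
    fix i j assume ij: "i < dim_row (?A * U)" "j < dim_col (?A * U)"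
    then have ij: "i < Suc n" "j < Suc n" by (auto simp: U_def)
    have "(?A * U) $$ (i, j) = (\<Sum>k<Suc n. f i k * (if k = j then 1 else if j = Suc k then a else 0))"
      using ij by (simp add: U_def scalar_prod_def atLeast0LessThan del: sum.lessThan_Suc)
    also have "\<dots> = (\<Sum>k<Suc n. (if k = j then f i k else 0) + (if j = Suc k then a * f i k else 0))"
      by (intro sum.cong) auto
    also have "\<dots> = f i j + (\<Sum>k<Suc n. if j = Suc k then a * f i k else 0)"
      using ij by (simp add: sum.distrib del: sum.lessThan_Suc)
    also have "\<dots> = ?B $$ (i, j)"
      using ij by (cases j) (auto simp del: sum.lessThan_Suc)
    finally show "?B $$ (i, j) = (?A * U) $$ (i, j)" by simp
  qed (auto simp: U_def)
  ultimately show ?thesis using det_mult[of ?A "Suc n" U] U by simp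
qed

lemma det_first_row:
  assumes "\<And>j. j < n \<Longrightarrow> f 0 (Suc j) = 0"
  shows "det (mat (Suc n) (Suc n) (\<lambda>(i, j). f i j)) = f 0 0 * det (mat n n (\<lambda>(i, j). f (Suc i) (Suc j)))"
  (is "det ?A = _ * det ?B")
proof -
  have "det ?A = (\<Sum>j<Suc n. ?A $$ (0, j) * cofactor ?A 0 j)"
    by (rule laplace_expansion_row) auto
  also have "\<dots> = f 0 0 * cofactor ?A 0 0"
    by (subst sum.lessThan_Suc_shift) (auto simp: assms)
  also have "cofactor ?A 0 0 = det (mat_delete ?A 0 0)" by (simp add: cofactor_def)
  also have "mat_delete ?A 0 0 = ?B" by (rule eq_matI) (auto simp: mat_delete_def)
  finally show ?thesis .
qed

text \<open>The counterpart of the frozen corner: after adding \<open>a\<close> times the previous column to each column, the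
factor \<open>a - s q\<close> kills the first row except for its first entry.\<close>

lemma det_dw_mat_corner:
  assumes q: "q \<noteq> 0" "q\<^sup>2 \<noteq> 1" and a: "a \<noteq> 0" and ss: "0 \<notin> set ss"
  shows "det (dw_mat q (a # as) (a / q # ss)) =
    poly (row_poly as) (- (a / q) / q) * (\<Prod>s\<leftarrow>ss. (a - s * q) * (a - s / q)) * det (dw_mat q as ss)"
proof -
  define n where "n = length ss"
  define f where "f = (\<lambda>i j. dw_fun q (a # as) j ((a / q # ss) ! i))"
  define g where "g = (\<lambda>i j. case j of 0 \<Rightarrow> f i 0 | Suc k \<Rightarrow> f i (Suc k) + a * f i k)"
  have nz: "ss ! i \<noteq> 0" if "i < n" for i using that ss by (auto simp: n_def set_conv_nth)
  have "det (dw_mat q (a # as) (a / q # ss)) = det (mat (Suc n) (Suc n) (\<lambda>(i, j). f i j))"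
    by (simp add: dw_mat_def n_def f_def)
  also have "\<dots> = det (mat (Suc n) (Suc n) (\<lambda>(i, j). g i j))"
    unfolding g_def by (rule det_add_previous_columns)
  also have "\<dots> = g 0 0 * det (mat n n (\<lambda>(i, j). g (Suc i) (Suc j)))"
  proof (rule det_first_row)
    fix j
    have "a / q \<noteq> 0" using a q by simp
    from dw_fun_Cons[OF q(1) this, of a as j] show "g 0 (Suc j) = 0"
      using q by (simp add: g_def f_def)
  qed
  also have "mat n n (\<lambda>(i, j). g (Suc i) (Suc j)) =
     mat n n (\<lambda>(i, j). ((a - ss ! i * q) * (a - ss ! i / q)) * dw_fun q as j (ss ! i))"
    by (rule eq_matI) (auto simp: g_def f_def dw_fun_Cons[OF q(1) nz])
  also have "det \<dots> = (\<Prod>i<n. (a - ss ! i * q) * (a - ss ! i / q)) * det (dw_mat q as ss)"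
    unfolding det_scale_rows by (simp add: dw_mat_def n_def)
  also have "(\<Prod>i<n. (a - ss ! i * q) * (a - ss ! i / q)) = (\<Prod>s\<leftarrow>ss. (a - s * q) * (a - s / q))"
    unfolding prod.list_conv_set_nth by (simp add: n_def atLeast0LessThan)
  also have "g 0 0 = poly (row_poly as) (- (a / q) / q)"
    using dw_fun_corner[OF q a] by (simp add: g_def f_def)
  finally show ?thesis by simp
qed

section \<open>The determinant formula by interpolation\<close>

definition vandermonde :: "'a::comm_ring_1 list \<Rightarrow> 'a" where
  "vandermonde ss = (\<Prod>i<length ss. \<Prod>l<i. ss ! i - ss ! l)"

lemma vandermonde_Cons: "vandermonde (s # ss) = (\<Prod>x\<leftarrow>ss. x - s) * vandermonde ss"
proof -
  have "vandermonde (s # ss) = (\<Prod>i<length ss. \<Prod>l<Suc i. (s # ss) ! Suc i - (s # ss) ! l)"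
    unfolding vandermonde_def by (simp add: prod.lessThan_Suc_shift del: prod.lessThan_Suc)
  also have "\<dots> = (\<Prod>i<length ss. (ss ! i - s) * (\<Prod>l<i. ss ! i - ss ! l))"
    by (simp add: prod.lessThan_Suc_shift del: prod.lessThan_Suc)
  also have "\<dots> = (\<Prod>x\<leftarrow>ss. x - s) * vandermonde ss"
    by (simp add: prod.distrib vandermonde_def prod.list_conv_set_nth atLeast0LessThan)
  finally show ?thesis .
qed

lemma vandermonde_repeated:
  assumes "x \<in> set ss" shows "vandermonde (x # ss) = 0"
proof -
  have "(\<Prod>y\<leftarrow>ss. y - x) = 0" using assms by (induction ss) auto
  then show ?thesis by (simp add: vandermonde_Cons)
qed

text \<open>The conditions under which the interpolation works: the nodes \<open>a / q\<close> and the remaining column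
parameters are pairwise distinct, the closed form may be divided by the column parameters, and rows
may be exchanged.\<close>

definition generic_params :: "'a::field \<Rightarrow> 'a list \<Rightarrow> 'a list \<Rightarrow> bool" where
  "generic_params q as ss \<longleftrightarrow> distinct as \<and> distinct ss \<and> 0 \<notin> set as \<and> 0 \<notin> set ss
     \<and> (\<forall>a\<in>set as. \<forall>s\<in>set ss. a / q \<noteq> s)
     \<and> (\<forall>a\<in>set as. \<forall>b\<in>set as. a \<noteq> b \<longrightarrow> q\<^sup>2 * a \<noteq> b)"

lemma prod_list_scale: "(\<Prod>x\<leftarrow>xs. c * f x) = c ^ length xs * (\<Prod>x\<leftarrow>xs. f x :: 'a::comm_monoid_mult)"
  by (induction xs) (auto simp: ac_simps)

lemma prod_list_mult: "(\<Prod>x\<leftarrow>xs. f x * g x) = (\<Prod>x\<leftarrow>xs. f x) * (\<Prod>x\<leftarrow>xs. g x :: 'a::comm_monoid_mult)"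
  by (induction xs) (auto simp: ac_simps)

text \<open>Expansion along the first row, the only one that involves \<open>x\<close>.\<close>

lemma det_dw_mat_degree_first_column:
  assumes "length as = Suc n" "length ss = n"
  shows "polynomial_le (2 * n) (\<lambda>x. det (dw_mat q as (x # ss)))"
proof -
  have "det (dw_mat q as (x # ss)) = (\<Sum>j<Suc n. det (mat_delete (dw_mat q as (0 # ss)) 0 j) * (-1) ^ j * dw_fun q as j x)" for x
  proof -
    have "det (dw_mat q as (x # ss)) = (\<Sum>j<Suc n. dw_mat q as (x # ss) $$ (0, j) * cofactor (dw_mat q as (x # ss)) 0 j)"
      by (rule laplace_expansion_row) (auto simp: dw_mat_def assms)
    also have "\<dots> = (\<Sum>j<Suc n. det (mat_delete (dw_mat q as (0 # ss)) 0 j) * (-1) ^ j * dw_fun q as j x)"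
    proof (rule sum.cong[OF refl])
      fix j assume j: "j \<in> {..<Suc n}"
      have "mat_delete (dw_mat q as (x # ss)) 0 j = mat_delete (dw_mat q as (0 # ss)) 0 j"
        by (rule eq_matI) (auto simp: mat_delete_def dw_mat_def)
      then show "dw_mat q as (x # ss) $$ (0, j) * cofactor (dw_mat q as (x # ss)) 0 j =
        det (mat_delete (dw_mat q as (0 # ss)) 0 j) * (-1) ^ j * dw_fun q as j x"
        using j assms by (simp add: cofactor_def dw_mat_def)
    qed
    finally show ?thesis .
  qed
  moreover have "polynomial_le (2 * n)
     (\<lambda>x. \<Sum>j<Suc n. det (mat_delete (dw_mat q as (0 # ss)) 0 j) * (-1) ^ j * dw_fun q as j x)"
    by (intro polynomial_le_sum polynomial_le_cmult polynomial_le_mono[OF dw_fun_degree]) (auto simp: assms)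
  ultimately show ?thesis by simp
qed

lemma det_dw_mat_repeated:
  assumes "x \<in> set ss" shows "det (dw_mat q as (x # ss)) = 0"
proof -
  obtain i where i: "i < length ss" "ss ! i = x" using assms by (auto simp: set_conv_nth)
  show ?thesis
  proof (rule det_identical_rows[of _ "Suc (length ss)" 0 "Suc i"])
    show "row (dw_mat q as (x # ss)) 0 = row (dw_mat q as (x # ss)) (Suc i)"
      using i by (intro eq_vecI) (auto simp: dw_mat_def)
  qed (use i in \<open>auto simp: dw_mat_def\<close>)
qed

text \<open>Both sides of the claimed identity pick up the same factors when the corner is frozen: the powers of
\<open>q\<close> from the \<open>n\<close> weights \<open>q b - a / q\<close> and the \<open>n\<close> weights \<open>q a - x\<close> cancel against the two powers of
\<open>-1/q\<close> from the Vandermonde factors \<open>x - a / q\<close> and from the prefactor.\<close>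

lemma det_dw_mat_eq_dwbc_corner:
  assumes q: "q \<noteq> 0" "q\<^sup>2 \<noteq> 1" and a: "a \<noteq> 0" and ss: "0 \<notin> set ss"
    and len: "length as = n" "length ss = n"
    and IH: "det (dw_mat q as ss) = vandermonde ss * (\<Prod>i<n. (- 1 / q) ^ i) * dwbc q as ss (replicate n False)"
  shows "det (dw_mat q (a # as) (a / q # ss)) =
    vandermonde (a / q # ss) * (\<Prod>i<Suc n. (- 1 / q) ^ i) * dwbc q (a # as) (a / q # ss) (replicate (Suc n) False)"
proof -
  have "poly (row_poly as) (- (a / q) / q) = (\<Prod>b\<leftarrow>as. b - a / q / q)"
    by (simp add: poly_row_poly)
  then have 1: "(\<Prod>b\<leftarrow>as. q * b - a / q) = q ^ n * poly (row_poly as) (- (a / q) / q)"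
    using prod_list_scale[of q "\<lambda>b. b - a / q / q" as] q len by (simp add: algebra_simps)
  have 2: "(\<Prod>x\<leftarrow>ss. x - a / q) = (- 1 / q) ^ n * (\<Prod>x\<leftarrow>ss. a - x * q)"
    using prod_list_scale[of "- 1 / q" "\<lambda>x. a - x * q" ss] q len by (simp add: algebra_simps diff_divide_distrib)
  have 3: "(\<Prod>x\<leftarrow>ss. q * a - x) = q ^ n * (\<Prod>x\<leftarrow>ss. a - x / q)"
    using prod_list_scale[of q "\<lambda>x. a - x / q" ss] q len by (simp add: algebra_simps)
  have 4: "(- 1 / q) ^ n * (- 1 / q) ^ n * q ^ n * q ^ n = 1"
    using q by (simp flip: power_mult_distrib)
  have "vandermonde (a / q # ss) * (\<Prod>i<Suc n. (- 1 / q) ^ i) * dwbc q (a # as) (a / q # ss) (replicate (Suc n) False) =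
    ((- 1 / q) ^ n * (- 1 / q) ^ n * q ^ n * q ^ n) *
    (poly (row_poly as) (- (a / q) / q) * ((\<Prod>x\<leftarrow>ss. a - x * q) * (\<Prod>x\<leftarrow>ss. a - x / q))
      * (vandermonde ss * (\<Prod>i<n. (- 1 / q) ^ i) * dwbc q as ss (replicate n False)))"
    unfolding vandermonde_Cons dwbc_frozen_corner[OF q(1) len(2)] 1 2 3 prod.lessThan_Suc
    by (simp only: ac_simps)
  then show ?thesis
    unfolding 4 det_dw_mat_corner[OF q a ss] IH prod_list_mult by (simp only: mult_1 ac_simps)
qed

text \<open>The determinant formula for distinct column parameters, by induction on the size. Both sides are
polynomials of degree at most \<open>2 n\<close> in the first column parameter. They agree at the \<open>n\<close> other column
parameters, where both vanish, and at the \<open>n + 1\<close> values \<open>a / q\<close>: there any row \<open>a\<close> may be moved to the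
top by the Yang-Baxter equation, and the frozen corner reduces the claim to size \<open>n\<close>.\<close>

theorem det_dw_mat_eq_dwbc_generic:
  assumes q: "q \<noteq> 0" "q\<^sup>2 \<noteq> 1"
  shows "length as = n \<Longrightarrow> length ss = n \<Longrightarrow> generic_params q as ss \<Longrightarrow>
    det (dw_mat q as ss) = vandermonde ss * (\<Prod>i<n. (- 1 / q) ^ i) * dwbc q as ss (replicate n False)"
proof (induction n arbitrary: as ss)
  case 0
  then show ?case by (simp add: dw_mat_def vandermonde_def)
next
  case (Suc n)
  then obtain s ts where ss: "ss = s # ts" and ts: "length ts = n" by (cases ss) auto
  note gen = Suc.prems(3)[unfolded ss generic_params_def]
  let ?S = "set ts \<union> (\<lambda>a. a / q) ` set as"
  have card: "card ?S = Suc (2 * n)"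
  proof -
    have "card ((\<lambda>a. a / q) ` set as) = Suc n"
      using gen q Suc.prems(1) by (subst card_image) (auto simp: inj_on_def distinct_card)
    moreover have "card (set ts) = n" using gen ts by (simp add: distinct_card)
    moreover have "set ts \<inter> (\<lambda>a. a / q) ` set as = {}" using gen by auto
    ultimately show ?thesis by (simp add: card_Un_disjoint)
  qed
  show ?case unfolding ss
  proof (rule polynomial_le_eqI[where S = ?S and d = "2 * n" and x = s
      and f = "\<lambda>x. det (dw_mat q as (x # ts))"
      and g = "\<lambda>x. vandermonde (x # ts) * (\<Prod>i<Suc n. (- 1 / q) ^ i)
        * dwbc q as (x # ts) (replicate (Suc n) False)"])
    show "polynomial_le (2 * n) (\<lambda>x. det (dw_mat q as (x # ts)))"
      by (rule det_dw_mat_degree_first_column[OF Suc.prems(1) ts])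
    have "polynomial_le n (\<lambda>x. \<Prod>y\<leftarrow>ts. y - x)"
      using polynomial_le_prod_list[of ts "\<lambda>y x. y - x"] polynomial_le_linear[of "-1"] ts
      by (auto simp: algebra_simps)
    then have "polynomial_le n (\<lambda>x. vandermonde (x # ts))"
      unfolding vandermonde_Cons by (subst mult.commute) (rule polynomial_le_cmult)
    moreover have "polynomial_le n (\<lambda>x. dwbc q as (x # ts) (replicate (Suc n) False))"
      using dwbc_degree_first_column[of as q ts "replicate n False"] Suc.prems(1) by simp
    ultimately show "polynomial_le (2 * n) (\<lambda>x. vandermonde (x # ts) * (\<Prod>i<Suc n. (- 1 / q) ^ i)
        * dwbc q as (x # ts) (replicate (Suc n) False))"
      using polynomial_le_mult[OF polynomial_le_cmult, of n _ n _ "\<Prod>i<Suc n. (- 1 / q) ^ i"]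
      by (simp add: mult_2 mult.commute[of "vandermonde _"] del: prod.lessThan_Suc)
    show "finite ?S" by simp
    show "2 * n < card ?S" using card by simp
    fix x assume "x \<in> ?S"
    then consider "x \<in> set ts" | a where "a \<in> set as" "x = a / q" by auto
    then show "det (dw_mat q as (x # ts)) = vandermonde (x # ts) * (\<Prod>i<Suc n. (- 1 / q) ^ i)
        * dwbc q as (x # ts) (replicate (Suc n) False)"
    proof cases
      case 1
      then show ?thesis by (simp add: det_dw_mat_repeated vandermonde_repeated)
    next
      case 2
      then obtain xs ys where as: "as = xs @ a # ys" by (meson split_list)
      have "det (dw_mat q (xs @ ys) ts) = vandermonde ts * (\<Prod>i<n. (- 1 / q) ^ i)
          * dwbc q (xs @ ys) ts (replicate n False)"
        using gen Suc.prems(1) ts by (intro Suc.IH) (auto simp: as generic_params_def)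
      then have "det (dw_mat q (a # xs @ ys) (a / q # ts)) = vandermonde (a / q # ts)
          * (\<Prod>i<Suc n. (- 1 / q) ^ i) * dwbc q (a # xs @ ys) (a / q # ts) (replicate (Suc n) False)"
        using gen Suc.prems(1) ts q by (intro det_dw_mat_eq_dwbc_corner) (auto simp: as)
      moreover have "dw_mat q as (a / q # ts) = dw_mat q (a # xs @ ys) (a / q # ts)"
        by (simp add: dw_mat_def dw_fun_def dw_coeff_def as ac_simps del: mult_pCons_left mult_pCons_right)
      moreover have "dwbc q as (a / q # ts) vs = dwbc q (a # xs @ ys) (a / q # ts) vs" for vs
        unfolding as
      proof (rule dwbc_row_to_front[OF q(1)])
        fix b assume "b \<in> set xs"
        moreover have "\<forall>a\<in>set as. \<forall>b\<in>set as. a \<noteq> b \<longrightarrow> q\<^sup>2 * a \<noteq> b" using gen by blast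
        moreover have "a \<notin> set xs" using gen by (simp add: as)
        ultimately show "q\<^sup>2 * a \<noteq> b" by (metis as in_set_conv_decomp Un_iff set_append)
      qed
      ultimately show ?thesis using 2 by simp
    qed
  qed
qed

section \<open>Coinciding parameters\<close>

text \<open>Complete homogeneous symmetric polynomials, which are the divided differences of powers.\<close>

fun hsym :: "nat \<Rightarrow> 'a::comm_ring_1 list \<Rightarrow> 'a" where
  "hsym 0 xs = 1"
| "hsym (Suc k) [] = 0"
| "hsym (Suc k) (x # xs) = hsym (Suc k) xs + x * hsym k (x # xs)"

text \<open>The defining recursion splits off the first variable; by symmetry the second one can be split off as
well.\<close>

lemma hsym_second:
  "hsym (Suc k) (x # y # xs) = hsym (Suc k) (x # xs) + y * hsym k (x # y # xs)"
proof (induction k)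
  case (Suc k)
  have "hsym (Suc (Suc k)) (x # y # xs)
    = hsym (Suc (Suc k)) xs + y * hsym (Suc k) (y # xs) + x * hsym (Suc k) (x # y # xs)" by simp
  also have "\<dots> = hsym (Suc (Suc k)) xs + y * hsym (Suc k) (y # xs)
      + x * (hsym (Suc k) (x # xs) + y * hsym k (x # y # xs))" by (simp only: Suc)
  also have "\<dots> = hsym (Suc (Suc k)) (x # xs) + y * hsym (Suc k) (x # y # xs)"
    by (simp add: algebra_simps)
  finally show ?case .
qed simp

text \<open>The difference of the two ways to split off a variable is the recursion for divided differences.\<close>

lemma hsym_exchange:
  "hsym (Suc k) (x # xs) = hsym (Suc k) (y # xs) + (x - y) * hsym k (x # y # xs)"
  using hsym_second[of k x y xs] hsym.simps(3)[of k x "y # xs"] by (simp only: algebra_simps)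

lemma hsym_single: "hsym k [x] = x ^ k"
  by (induction k) auto

lemma hsym_ones: "hsym k (replicate (Suc i) 1) = of_nat ((k + i) choose i)"
proof (induction k arbitrary: i)
  case (Suc k)
  note IHk = this
  show ?case
  proof (induction i)
    case 0
    then show ?case using IHk[of 0] by simp
  next
    case (Suc i)
    have "hsym (Suc k) (replicate (Suc (Suc i)) 1) =
      hsym (Suc k) (replicate (Suc i) 1) + hsym k (replicate (Suc (Suc i)) (1::'a))" by simp
    also have "\<dots> = of_nat (((Suc k + i) choose i) + ((k + Suc i) choose Suc i))"
      unfolding Suc IHk by simp
    also have "((Suc k + i) choose i) + ((k + Suc i) choose Suc i) = (Suc k + Suc i) choose Suc i"
      by simp
    finally show ?case .
  qed
qed simp

text \<open>The divided difference of the power with exponent \<open>k\<close> at \<open>i + 1\<close> nodes.\<close>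

definition power_divdiff :: "nat \<Rightarrow> nat \<Rightarrow> 'a::comm_ring_1 list \<Rightarrow> 'a" where
  "power_divdiff k i xs = (if i \<le> k then hsym (k - i) xs else 0)"

lemma power_divdiff_exchange:
  "power_divdiff k i (x # xs) = power_divdiff k i (y # xs) + (x - y) * power_divdiff k (Suc i) (x # y # xs)"
proof (cases "k \<le> i")
  case False
  then have "k - i = Suc (k - Suc i)" by simp
  then show ?thesis using False hsym_exchange[of "k - Suc i" x xs y] by (simp add: power_divdiff_def)
qed (auto simp: power_divdiff_def)

text \<open>Newton interpolation with remainder. The node lists are reversed so that each step adds a node at the
head, as in \<open>power_divdiff_exchange\<close>.\<close>

lemma newton_expansion:
  assumes "M \<le> length ss"
  shows "t ^ k = (\<Sum>m<M. (\<Prod>l<m. t - ss ! l) * power_divdiff k m (rev (take (Suc m) ss)))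
    + (\<Prod>l<M. t - ss ! l) * power_divdiff k M (t # rev (take M ss))"
  using assms
proof (induction M)
  case 0
  then show ?case by (simp add: power_divdiff_def hsym_single)
next
  case (Suc M)
  then have "rev (take (Suc M) ss) = ss ! M # rev (take M ss)"
    by (simp add: take_Suc_conv_app_nth)
  then show ?case using Suc power_divdiff_exchange[of k M t "rev (take M ss)" "ss ! M"]
    by (simp add: algebra_simps)
qed

definition dw_newton :: "'a::field \<Rightarrow> 'a list \<Rightarrow> 'a list \<Rightarrow> 'a mat" where
  "dw_newton q as ss = mat (length ss) (length ss) (\<lambda>(i, j).
     \<Sum>m\<le>length as. dw_coeff q as j m * power_divdiff (m + j - 1) i (rev (take (Suc i) ss)))"

text \<open>Newton interpolation factors the matrix of values into a triangular matrix, whose determinant is the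
Vandermonde product, and the matrix of divided differences. The latter stays meaningful when nodes
coincide.\<close>

lemma det_dw_mat_newton: "det (dw_mat q as ss) = vandermonde ss * det (dw_newton q as ss)"
proof -
  define n where "n = length ss"
  define L where "L = mat n n (\<lambda>(i, m). \<Prod>l<m. ss ! i - ss ! l)"
  have L: "L \<in> carrier_mat n n" by (simp add: L_def)
  have "dw_mat q as ss = L * dw_newton q as ss"
  proof (rule eq_matI)
    fix i j assume "i < dim_row (L * dw_newton q as ss)" "j < dim_col (L * dw_newton q as ss)"
    then have ij: "i < n" "j < n" by (auto simp: L_def dw_newton_def n_def)
    have pw: "(ss ! i) ^ k = (\<Sum>c<n. (\<Prod>l<c. ss ! i - ss ! l) * power_divdiff k c (rev (take (Suc c) ss)))" for k
    proof -
      have "(\<Prod>l<n. ss ! i - ss ! l) = 0" using ij by auto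
      then show ?thesis using newton_expansion[of n ss "ss ! i" k] by (simp add: n_def)
    qed
    have "(L * dw_newton q as ss) $$ (i, j) = (\<Sum>c<n. (\<Prod>l<c. ss ! i - ss ! l) *
       (\<Sum>m\<le>length as. dw_coeff q as j m * power_divdiff (m + j - 1) c (rev (take (Suc c) ss))))"
      using ij by (simp add: L_def dw_newton_def n_def scalar_prod_def atLeast0LessThan)
    also have "\<dots> = (\<Sum>m\<le>length as. dw_coeff q as j m * (ss ! i) ^ (m + j - 1))"
      unfolding pw sum_distrib_left by (subst sum.swap) (simp add: ac_simps)
    finally show "dw_mat q as ss $$ (i, j) = (L * dw_newton q as ss) $$ (i, j)"
      using ij by (simp add: dw_mat_def n_def dw_fun_def)
  qed (auto simp: L_def dw_newton_def dw_mat_def n_def)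
  moreover have "det L = vandermonde ss"
  proof -
    have "det L = prod_list (diag_mat L)"
      by (rule det_lower_triangular[OF _ L]) (auto simp: L_def)
    also have "diag_mat L = map (\<lambda>i. \<Prod>l<i. ss ! i - ss ! l) [0..<n]"
      unfolding diag_mat_def using L by (intro map_cong) (auto simp: L_def)
    also have "prod_list \<dots> = vandermonde ss"
      by (simp add: vandermonde_def n_def prod.list_conv_set_nth atLeast0LessThan)
    finally show ?thesis .
  qed
  ultimately show ?thesis
    using det_mult[OF L, of "dw_newton q as ss"] by (simp add: dw_newton_def n_def)
qed

text \<open>The dependence of both sides on a deformation parameter, where no degree bound is needed.\<close>

definition polynomial_fun :: "('a::comm_ring_1 \<Rightarrow> 'a) \<Rightarrow> bool" where
  "polynomial_fun f \<longleftrightarrow> (\<exists>p. \<forall>x. f x = poly p x)"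

named_theorems polynomial_fun_intros

lemma polynomial_funI: "(\<And>x. f x = poly p x) \<Longrightarrow> polynomial_fun f"
  by (auto simp: polynomial_fun_def)

lemma polynomial_fun_const [polynomial_fun_intros]: "polynomial_fun (\<lambda>x. c)"
  by (rule polynomial_funI[of _ "[:c:]"]) auto

lemma polynomial_fun_power [polynomial_fun_intros]: "polynomial_fun (\<lambda>x. x ^ k)"
  by (rule polynomial_funI[of _ "monom 1 k"]) (auto simp: poly_monom)

lemma polynomial_fun_add [polynomial_fun_intros]:
  "polynomial_fun f \<Longrightarrow> polynomial_fun g \<Longrightarrow> polynomial_fun (\<lambda>x. f x + g x)"
  unfolding polynomial_fun_def by (metis poly_add)

lemma polynomial_fun_diff [polynomial_fun_intros]:
  "polynomial_fun f \<Longrightarrow> polynomial_fun g \<Longrightarrow> polynomial_fun (\<lambda>x. f x - g x)"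
  unfolding polynomial_fun_def by (metis poly_diff)

lemma polynomial_fun_mult [polynomial_fun_intros]:
  "polynomial_fun f \<Longrightarrow> polynomial_fun g \<Longrightarrow> polynomial_fun (\<lambda>x. f x * g x)"
  unfolding polynomial_fun_def by (metis poly_mult)

lemma polynomial_fun_sum [polynomial_fun_intros]:
  "(\<And>i. i \<in> I \<Longrightarrow> polynomial_fun (f i)) \<Longrightarrow> polynomial_fun (\<lambda>x. \<Sum>i\<in>I. f i x)"
  by (induction I rule: infinite_finite_induct) (auto intro: polynomial_fun_intros)

lemma polynomial_fun_prod [polynomial_fun_intros]:
  "(\<And>i. i \<in> I \<Longrightarrow> polynomial_fun (f i)) \<Longrightarrow> polynomial_fun (\<lambda>x. \<Prod>i\<in>I. f i x)"
  by (induction I rule: infinite_finite_induct) (auto intro: polynomial_fun_intros)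

lemma polynomial_fun_det:
  assumes "\<And>i j. i < n \<Longrightarrow> j < n \<Longrightarrow> polynomial_fun (\<lambda>t. f t i j)"
  shows "polynomial_fun (\<lambda>t. det (mat n n (\<lambda>(i, j). f t i j)))"
proof -
  have less: "p i < n" if "p permutes {0..<n}" "i < n" for p i
    using permutes_in_image[OF that(1), of i] that(2) by simp
  have "det (mat n n (\<lambda>(i, j). f t i j)) =
    (\<Sum>p\<in>{p. p permutes {0..<n}}. signof p * (\<Prod>i = 0..<n. f t i (p i)))" for t
    by (subst det_def'[of _ n]) (auto intro!: sum.cong prod.cong simp: less)
  then show ?thesis
    by (auto intro!: polynomial_fun_intros assms simp: less)
qed

lemma polynomial_fun_coeff_row_poly:
  assumes "\<And>f. f \<in> set fs \<Longrightarrow> polynomial_fun f"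
  shows "polynomial_fun (\<lambda>t. coeff (row_poly (map (\<lambda>f. f t) fs)) m)"
  using assms
proof (induction fs arbitrary: m)
  case (Cons f fs)
  then show ?case by (cases m) (auto intro!: polynomial_fun_intros)
qed (auto intro: polynomial_fun_intros)

lemma polynomial_fun_hsym:
  assumes "\<And>f. f \<in> set fs \<Longrightarrow> polynomial_fun f"
  shows "polynomial_fun (\<lambda>t. hsym k (map (\<lambda>f. f t) fs))"
  using assms
proof (induction k arbitrary: fs)
  case (Suc k)
  note IHk = Suc.IH
  show ?case using Suc.prems
  proof (induction fs)
    case (Cons f fs)
    have "polynomial_fun (\<lambda>t. hsym k (map (\<lambda>f. f t) (f # fs)))"
      by (rule IHk) (rule Cons.prems)
    then show ?case using Cons by (auto intro!: polynomial_fun_intros)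
  qed (auto intro: polynomial_fun_intros)
qed (auto intro: polynomial_fun_intros)

lemma polynomial_fun_power_divdiff:
  assumes "\<And>f. f \<in> set fs \<Longrightarrow> polynomial_fun f"
  shows "polynomial_fun (\<lambda>t. power_divdiff k i (map (\<lambda>f. f t) fs))"
  using polynomial_fun_hsym[OF assms] polynomial_fun_const
  by (cases "i \<le> k") (simp_all add: power_divdiff_def)

lemma polynomial_fun_row_transfer:
  assumes "polynomial_fun g" "\<And>f. f \<in> set fs \<Longrightarrow> polynomial_fun f" "\<And>u. polynomial_fun (\<lambda>t. F t u)"
  shows "polynomial_fun (\<lambda>t. row_transfer q (g t) h (map (\<lambda>f. f t) fs) vs (F t))"
  using assms(2,3)
proof (induction fs arbitrary: h vs F)
  case Nil
  then show ?case by (cases h) (auto intro: polynomial_fun_intros)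
next
  case (Cons f fs)
  show ?case
  proof (cases vs)
    case (Cons v ws)
    have "polynomial_fun (\<lambda>t. if h then (q\<^sup>2 - 1)\<^sup>2 * g t * f t / q else 1)"
      using assms(1) Cons.prems(1)[of f] unfolding divide_inverse
      by (cases h) (auto intro!: polynomial_fun_intros)
    moreover have "polynomial_fun f" using Cons.prems(1) by simp
    moreover have "polynomial_fun (\<lambda>t. row_transfer q (g t) k (map (\<lambda>f. f t) fs) ws (\<lambda>u. F t (w # u)))" for k w
      using Cons.prems by (intro Cons.IH) auto
    ultimately have
      "polynomial_fun (\<lambda>t. (q * f t - g t) * row_transfer q (g t) h (map (\<lambda>f. f t) fs) ws (\<lambda>u. F t (v # u))
         + (if h then (q\<^sup>2 - 1)\<^sup>2 * g t * f t / q else 1)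
           * row_transfer q (g t) (\<not> h) (map (\<lambda>f. f t) fs) ws (\<lambda>u. F t ((\<not> v) # u)))"
      "polynomial_fun (\<lambda>t. (q * g t - f t) * row_transfer q (g t) h (map (\<lambda>f. f t) fs) ws (\<lambda>u. F t (v # u)))"
      using assms(1) by (auto simp del: if_split intro!: polynomial_fun_intros)
    then show ?thesis unfolding Cons list.map row_transfer.simps
      by (cases "h = v") (simp_all only: if_True if_False simp_thms)
  qed (auto intro: polynomial_fun_intros)
qed

lemma polynomial_fun_dwbc:
  assumes "\<And>f. f \<in> set fs \<Longrightarrow> polynomial_fun f" "\<And>f. f \<in> set gs \<Longrightarrow> polynomial_fun f"
  shows "polynomial_fun (\<lambda>t. dwbc q (map (\<lambda>f. f t) fs) (map (\<lambda>f. f t) gs) vs)"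
  using assms(1)
proof (induction fs arbitrary: vs)
  case (Cons f fs)
  then show ?case unfolding list.map dwbc.simps
    by (auto intro: polynomial_fun_row_transfer simp: assms(2))
qed (auto intro: polynomial_fun_intros)

lemma polynomial_fun_eqI:
  fixes f g :: "'a::idom \<Rightarrow> 'a"
  assumes "infinite (UNIV :: 'a set)" "polynomial_fun f" "polynomial_fun g"
    and "eventually (\<lambda>x. f x = g x) cofinite"
  shows "f x = g x"
proof -
  from assms obtain p r where p: "\<And>x. f x = poly p x" and r: "\<And>x. g x = poly r x"
    by (auto simp: polynomial_fun_def)
  have "p - r = 0"
  proof (rule ccontr)
    assume "p - r \<noteq> 0"
    then have "finite {x. poly (p - r) x = 0}" by (rule poly_roots_finite)
    then have "finite {x. f x = g x}" by (simp add: p r)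
    moreover have "finite {x. f x \<noteq> g x}" using assms(4) by (simp add: eventually_cofinite)
    ultimately have "finite ({x. f x = g x} \<union> {x. f x \<noteq> g x})" by simp
    moreover have "{x. f x = g x} \<union> {x. f x \<noteq> g x} = UNIV" by auto
    ultimately show False using assms(1) by simp
  qed
  then show ?thesis using p r by simp
qed

lemma eventually_generic_pair:
  fixes c u v :: "'a::idom"
  assumes "j \<noteq> k"
  shows "eventually (\<lambda>t. c * (u + t ^ Suc j) \<noteq> v + t ^ Suc k) cofinite"
proof -
  define p where "p = smult c ([:u:] + monom 1 (Suc j)) - ([:v:] + monom 1 (Suc k))"
  have "coeff p (Suc k) = -1" using assms by (simp add: p_def)
  then have "p \<noteq> 0" by auto
  then have "finite {t. poly p t = 0}" by (rule poly_roots_finite)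
  then show ?thesis by (simp add: p_def eventually_cofinite poly_monom)
qed


text \<open>The determinant formula without genericity conditions. The parameters are deformed along a polynomial
curve in \<open>t\<close> on which the conditions fail for finitely many \<open>t\<close> only, and both sides are polynomials
in \<open>t\<close>; the original parameters are at \<open>t = 0\<close>.\<close>

theorem det_dw_newton_eq_dwbc:
  fixes q :: "'a::field"
  assumes inf: "infinite (UNIV :: 'a set)" and q: "q \<noteq> 0" "q\<^sup>2 \<noteq> 1"
    and len: "length as = n" "length ss = n"
  shows "det (dw_newton q as ss) = (\<Prod>i<n. (- 1 / q) ^ i) * dwbc q as ss (replicate n False)"
proof -
  \<comment> \<open>All \<open>2 n\<close> parameters are perturbed by different powers of \<open>t\<close>, so that no two of them are
    proportional as polynomials. The extra curve with index \<open>2 n\<close> serves only to express that the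
    others are nonzero, as an inequality with the factor \<open>c = 0\<close>.\<close>
  define \<beta> where "\<beta> = (\<lambda>j. (as @ ss @ [0]) ! j)"
  define X where "X = (\<lambda>j t. \<beta> j + t ^ Suc j)"
  define fs where "fs = map X [0..<n]"
  define gs where "gs = map X [n..<2 * n]"
  let ?as = "\<lambda>t. map (\<lambda>f. f t) fs" and ?ss = "\<lambda>t. map (\<lambda>f. f t) gs"
  have X: "polynomial_fun (X j)" for j
    unfolding X_def by (intro polynomial_fun_intros)
  have fs: "polynomial_fun f" if "f \<in> set fs \<union> set gs" for f
    using that X by (auto simp: fs_def gs_def)
  have [simp]: "length fs = n" "length gs = n" by (simp_all add: fs_def gs_def)
  have at0: "?as 0 = as" "?ss 0 = ss"
    using len by (auto intro!: nth_equalityI simp: fs_def gs_def X_def \<beta>_def nth_append)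
  have "polynomial_fun (\<lambda>t. det (dw_newton q (?as t) (?ss t)))"
    unfolding dw_newton_def dw_coeff_def length_map take_map rev_map
    by (intro polynomial_fun_det polynomial_fun_intros polynomial_fun_coeff_row_poly
        polynomial_fun_power_divdiff) (use fs in \<open>auto dest: in_set_takeD\<close>)
  moreover have "polynomial_fun (\<lambda>t. (\<Prod>i<n. (- 1 / q) ^ i) * dwbc q (?as t) (?ss t) (replicate n False))"
    using fs by (intro polynomial_fun_intros polynomial_fun_dwbc) auto
  moreover have "eventually (\<lambda>t. det (dw_newton q (?as t) (?ss t)) =
    (\<Prod>i<n. (- 1 / q) ^ i) * dwbc q (?as t) (?ss t) (replicate n False)) cofinite"
  proof -
    have "eventually (\<lambda>t. \<forall>j\<in>{..2*n}. \<forall>k\<in>{..2*n}. \<forall>c\<in>{0, 1, 1 / q, q\<^sup>2}. j \<noteq> k \<longrightarrow> c * X j t \<noteq> X k t) cofinite"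
      unfolding X_def using eventually_generic_pair[where ?'a = 'a]
      by (intro eventually_ball_finite ballI) (auto simp: eventually_const_iff intro: always_eventually)
    then show ?thesis
    proof eventually_elim
      case (elim t)
      have ne: "c * X j t \<noteq> X k t" if "j \<le> 2 * n" "k \<le> 2 * n" "j \<noteq> k" "c \<in> {0, 1, 1 / q, q\<^sup>2}" for c j k
        using elim that by blast
      have inj: "inj_on (\<lambda>j. X j t) {..2 * n}"
        using ne[where c = 1] by (auto simp: inj_on_def)
      have nz: "X k t \<noteq> 0" if "k < 2 * n" for k
        using ne[of "2 * n" k 0] that by auto
      have "generic_params q (?as t) (?ss t)"
        unfolding generic_params_def
      proof (intro conjI)
        show "distinct (?as t)" "distinct (?ss t)"
          by (auto simp: fs_def gs_def distinct_map comp_def intro!: inj_on_subset[OF inj])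
        show "0 \<notin> set (?as t)" "0 \<notin> set (?ss t)"
          using nz by (auto simp: fs_def gs_def)
        show "\<forall>a\<in>set (?as t). \<forall>s\<in>set (?ss t). a / q \<noteq> s"
          using ne[where c = "1 / q"] by (auto simp: fs_def gs_def)
        show "\<forall>a\<in>set (?as t). \<forall>b\<in>set (?as t). a \<noteq> b \<longrightarrow> q\<^sup>2 * a \<noteq> b"
        proof (intro ballI impI)
          fix a b assume ab: "a \<in> set (?as t)" "b \<in> set (?as t)" "a \<noteq> b"
          then obtain j k where "j < n" "k < n" "a = X j t" "b = X k t" by (auto simp: fs_def)
          with ab(3) show "q\<^sup>2 * a \<noteq> b" using ne[of j k "q\<^sup>2"] by auto
        qed
      qed
      then have "vandermonde (?ss t) * det (dw_newton q (?as t) (?ss t)) =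
         vandermonde (?ss t) * ((\<Prod>i<n. (- 1 / q) ^ i) * dwbc q (?as t) (?ss t) (replicate n False))"
        using det_dw_mat_eq_dwbc_generic[OF q, of "?as t" n "?ss t"]
        by (simp add: det_dw_mat_newton mult.assoc)
      moreover have "vandermonde (?ss t) \<noteq> 0"
        using \<open>generic_params q (?as t) (?ss t)\<close>
        by (auto simp: vandermonde_def generic_params_def nth_eq_iff_index_eq simp del: nth_map)
      ultimately show ?case by simp
    qed
  qed
  ultimately have "det (dw_newton q (?as 0) (?ss 0)) =
    (\<Prod>i<n. (- 1 / q) ^ i) * dwbc q (?as 0) (?ss 0) (replicate n False)"
    by (rule polynomial_fun_eqI[OF inf])
  then show ?thesis by (simp only: at0)
qed

section \<open>The matrix K as a matrix of Taylor coefficients\<close>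

text \<open>Divided differences at equal nodes are Taylor coefficients, here at 1.\<close>

lemma dw_newton_ones:
  "dw_newton q as (replicate n 1) = mat n n (\<lambda>(i, j).
     \<Sum>m\<le>length as. dw_coeff q as j m * of_nat ((m + j - 1) choose i))"
proof -
  have "power_divdiff k i (replicate (Suc i) 1) = (of_nat (k choose i) :: 'a)" for k i
    by (auto simp: power_divdiff_def hsym_ones binomial_eq_0 simp del: replicate_Suc)
  moreover have "min n (Suc i) = Suc i" if "i < n" for i using that by simp
  ultimately show ?thesis
    by (intro eq_matI) (auto simp: dw_newton_def simp del: replicate_Suc)
qed

lemma coeff_row_poly_ones: "coeff (row_poly (replicate N 1)) m = of_nat (N choose m)"
proof (induction N arbitrary: m)
  case 0
  then show ?case by (cases m) auto
next
  case (Suc N)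
  then show ?case by (cases m) auto
qed

text \<open>Row parameters that are inhomogeneous in the top and bottom rows only.\<close>

definition boundary_rows :: "nat \<Rightarrow> 'a \<Rightarrow> 'a \<Rightarrow> 'a::field list" where
  "boundary_rows n \<alpha> \<beta> = \<alpha> # replicate (n - 2) 1 @ [\<beta>]"

lemma coeff_row_poly_boundary_rows:
  assumes "n \<ge> 2"
  shows "coeff (row_poly (boundary_rows n \<alpha> \<beta>)) m =
    of_nat (int_binom (int n - 2) (int m - 2)) + (\<alpha> + \<beta>) * of_nat (int_binom (int n - 2) (int m - 1))
    + \<alpha> * \<beta> * of_nat (int_binom (int n - 2) (int m))"
proof -
  define N where "N = n - 2"
  have n: "int n - 2 = int N" using assms by (simp add: N_def)
  have b: "int_binom (int N) (int k) = N choose k" for k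
    by (auto simp: int_binom_def binomial_eq_0)
  have b0: "int_binom (int N) (-1) = 0" "int_binom (int N) (-2) = 0" by (auto simp: int_binom_def)
  have b1: "int_binom (int N) (int (Suc k) - 1) = N choose k" 
    "int_binom (int N) (int (Suc (Suc k)) - 2) = N choose k" for k
    using b[of k] by simp_all
  have "row_poly (boundary_rows n \<alpha> \<beta>) = [:\<alpha> * \<beta>, \<alpha> + \<beta>, 1:] * row_poly (replicate N 1)"
  proof -
    have "row_poly (boundary_rows n \<alpha> \<beta>) = [:\<alpha>, 1:] * (row_poly (replicate N 1) * [:\<beta>, 1:])"
      by (simp add: boundary_rows_def N_def del: mult_pCons_left mult_pCons_right)
    also have "\<dots> = ([:\<alpha>, 1:] * [:\<beta>, 1:]) * row_poly (replicate N 1)"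
      by (simp only: ac_simps)
    also have "[:\<alpha>, 1:] * [:\<beta>, 1:] = [:\<alpha> * \<beta>, \<alpha> + \<beta>, 1:]" by (simp add: add.commute)
    finally show ?thesis .
  qed
  moreover have "coeff ([:\<alpha> * \<beta>, \<alpha> + \<beta>, 1:] * row_poly (replicate N 1)) m =
    of_nat (int_binom (int N) (int m - 2)) + (\<alpha> + \<beta>) * of_nat (int_binom (int N) (int m - 1))
    + \<alpha> * \<beta> * of_nat (int_binom (int N) (int m))"
  proof -
    consider "m = 0" | "m = 1" | k where "m = Suc (Suc k)"
      by (metis One_nat_def not0_implies_Suc)
    then show ?thesis
    proof cases
      case 3
      have "int_binom (int N) (int m - 1) = N choose (Suc k)" "int_binom (int N) (int m - 2) = N choose k"
        "int_binom (int N) (int m) = N choose (Suc (Suc k))"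
        unfolding 3 b1 b by simp_all
      then show ?thesis by (simp add: 3 coeff_row_poly_ones algebra_simps)
    qed (use b[of 0] b[of 1] b0 in \<open>auto simp: coeff_row_poly_ones\<close>)
  qed
  ultimately show ?thesis by (simp add: n)
qed

text \<open>The bracket in \<open>K_entry\<close> is the coefficient of \<open>x\<^sup>m\<close> in \<open>(x + 1)\<^sup>n\<^sup>-\<^sup>2 (x + \<alpha>) (x + \<beta>)\<close>, where \<open>m = k + j\<close> with \<open>j\<close>
counted from 0; it vanishes unless \<open>0 \<le> m \<le> n\<close>, which cuts the sum down to the range of \<open>dw_fun\<close>.\<close>

lemma K_entry_eq:
  fixes q \<rho> \<tau> :: "'a::field"
  assumes n: "n \<ge> 2" and j: "j < n"
  defines "\<alpha> \<equiv> (\<rho> + q) / (1 + \<rho> * q)" and "\<beta> \<equiv> (1 + \<tau> * q) / (\<tau> + q)"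
  shows "K_entry n q \<rho> \<tau> (int i + 1) (int j + 1) =
    (\<Sum>m\<le>n. dw_coeff q (boundary_rows n \<alpha> \<beta>) j m * of_nat ((m + j - 1) choose i))"
proof -
  define B where "B = (\<lambda>m::int. of_nat (int_binom (int n - 2) (m - 2))
       + (\<alpha> + \<beta>) * of_nat (int_binom (int n - 2) (m - 1)) + \<alpha> * \<beta> * of_nat (int_binom (int n - 2) m))"
  define T where "T = (\<lambda>k. (-1) powi (k + 1) * ((q powi k - q powi (-k)) / (q - inverse q))
        * of_nat (int_binom (2 * int j + k - 1) (int i)) * B (k + int j))"
  have "K_entry n q \<rho> \<tau> (int i + 1) (int j + 1) = (\<Sum>k\<in>{- int n + 1..int n}. T k)"
    unfolding K_entry_def T_def B_def \<alpha>_def \<beta>_def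
    by (intro sum.cong refl) (simp add: algebra_simps)
  also have "\<dots> = (\<Sum>k\<in>{- int j..int n - int j}. T k)"
    using j by (intro sum.mono_neutral_right) (auto simp: T_def B_def int_binom_def)
  also have "\<dots> = (\<Sum>m\<le>n. T (int m - int j))"
    by (intro sum.reindex_bij_witness[of _ "\<lambda>m. int m - int j" "\<lambda>k. nat (k + int j)"]) auto
  also have "\<dots> = (\<Sum>m\<le>n. dw_coeff q (boundary_rows n \<alpha> \<beta>) j m * of_nat ((m + j - 1) choose i))"
  proof (intro sum.cong refl)
    fix m
    show "T (int m - int j) = dw_coeff q (boundary_rows n \<alpha> \<beta>) j m * of_nat ((m + j - 1) choose i)"
    proof (cases "m + j = 0")
      case True
      then show ?thesis by (simp add: T_def dw_coeff_def)
    next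
      case False
      have "(-1 :: 'a) powi (int m - int j + 1) = (-1) ^ (m + j + 1)"
        by (cases "even j") (simp_all add: power_int_add power_int_diff power_add)
      moreover have "int_binom (2 * int j + (int m - int j) - 1) (int i) = (m + j - 1) choose i"
        using False by (auto simp: int_binom_def binomial_eq_0 nat_diff_distrib' nat_add_distrib add.commute)
      moreover have "B (int m - int j + int j) = coeff (row_poly (boundary_rows n \<alpha> \<beta>)) m"
        by (simp add: B_def coeff_row_poly_boundary_rows[OF n])
      ultimately show ?thesis by (simp add: T_def dw_coeff_def)
    qed
  qed
  finally show ?thesis .
qed

lemma K_mat_eq_dw_newton:
  assumes "n \<ge> 2"
  shows "K_mat n q \<rho> \<tau> =
    dw_newton q (boundary_rows n ((\<rho> + q) / (1 + \<rho> * q)) ((1 + \<tau> * q) / (\<tau> + q))) (replicate n 1)"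
proof -
  have "length (boundary_rows n ((\<rho> + q) / (1 + \<rho> * q)) ((1 + \<tau> * q) / (\<tau> + q))) = n"
    using assms by (simp add: boundary_rows_def)
  then show ?thesis
    unfolding dw_newton_ones K_mat_def by (intro eq_matI) (auto simp: K_entry_eq[OF assms])
qed

section \<open>Alternating sign matrices as six-vertex states\<close>

text \<open>Alternation of signs, phrased by partial sums: \<open>asm_line h\<close> says that the partial sums, started at
\<open>h\<close>, remain in \<open>{0, 1}\<close> and end at 1.\<close>

fun asm_line :: "bool \<Rightarrow> int list \<Rightarrow> bool" where
  "asm_line h [] = h"
| "asm_line h (x # xs) =
     (x = 0 \<and> asm_line h xs \<or> x = (if h then - 1 else 1) \<and> asm_line (\<not> h) xs)"

lemma asm_line_filter: "asm_line h (filter (\<lambda>x. x \<noteq> 0) xs) = asm_line h xs"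
  by (induction xs arbitrary: h) auto

lemma asm_line_nonzero_iff:
  assumes "0 \<notin> set ys"
  shows "asm_line h ys \<longleftrightarrow> set ys \<subseteq> {1, -1} \<and> successively (\<noteq>) ((if h then 1 else - 1) # ys)
    \<and> last ((if h then 1 else - 1) # ys) = 1"
  using assms
proof (induction ys arbitrary: h)
  case (Cons y ys)
  define c where "c = (if h then 1 else - 1 :: int)"
  have "asm_line h (y # ys) \<longleftrightarrow> y = - c \<and> asm_line (\<not> h) ys"
    using Cons.prems by (auto simp: c_def)
  also have "\<dots> \<longleftrightarrow> y = - c \<and> set ys \<subseteq> {1, -1} \<and> successively (\<noteq>) (- c # ys) \<and> last (- c # ys) = 1"
    using Cons.IH[of "\<not> h"] Cons.prems by (cases h) (simp_all add: c_def)
  also have "\<dots> \<longleftrightarrow> (y \<in> {1, -1} \<and> c \<noteq> y) \<and> set ys \<subseteq> {1, -1} \<and> successively (\<noteq>) (y # ys) \<and> last (y # ys) = 1"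
    by (cases h) (auto simp: c_def)
  also have "\<dots> \<longleftrightarrow> set (y # ys) \<subseteq> {1, -1} \<and> successively (\<noteq>) (c # y # ys) \<and> last (c # y # ys) = 1"
    by auto
  finally show ?case unfolding c_def .
qed simp

lemma alternating_signs_iff_asm_line: "alternating_signs xs \<longleftrightarrow> asm_line False xs"
proof -
  let ?ys = "filter (\<lambda>x. x \<noteq> 0) xs"
  have "asm_line False xs \<longleftrightarrow> asm_line False ?ys" by (simp only: asm_line_filter)
  also have "\<dots> \<longleftrightarrow> set ?ys \<subseteq> {1, -1} \<and> successively (\<noteq>) (- 1 # ?ys) \<and> last (- 1 # ?ys) = 1"
    by (subst asm_line_nonzero_iff) (simp_all only: if_False set_filter mem_Collect_eq simp_thms)
  also have "\<dots> \<longleftrightarrow> alternating_signs xs"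
  proof -
    have "set ys \<subseteq> {1, -1} \<and> successively (\<noteq>) (- 1 # ys) \<and> last (- 1 # ys) = 1 \<longleftrightarrow>
      set ys \<subseteq> {1, -1} \<and> ys \<noteq> [] \<and> hd ys = 1 \<and> last ys = 1 \<and> successively (\<noteq>) ys" for ys :: "int list"
      by (cases ys) auto
    then show ?thesis unfolding alternating_signs_def Let_def by (simp only:)
  qed
  finally show ?thesis ..
qed

text \<open>The rows that can stand below the column sums \<open>vs\<close> when the row sum starts at \<open>h\<close>.\<close>

fun admissible_rows :: "bool \<Rightarrow> bool list \<Rightarrow> int list set" where
  "admissible_rows h [] = (if h then {[]} else {})"
| "admissible_rows h (v # vs) = (#) 0 ` admissible_rows h vs
     \<union> (if h = v then (#) (if h then - 1 else 1) ` admissible_rows (\<not> h) vs else {})"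

definition flip_columns :: "bool list \<Rightarrow> int list \<Rightarrow> bool list" where
  "flip_columns = map2 (\<lambda>v x. v \<noteq> (x \<noteq> 0))"

lemma flip_columns_simps [simp]:
  "flip_columns [] [] = []" "flip_columns (v # vs) (x # xs) = (v \<noteq> (x \<noteq> 0)) # flip_columns vs xs"
  by (simp_all add: flip_columns_def)

text \<open>The weights of \<open>row_transfer\<close> at column parameters 1, entry by entry.\<close>

fun row_weight :: "'a::field \<Rightarrow> 'a \<Rightarrow> bool \<Rightarrow> bool list \<Rightarrow> int list \<Rightarrow> 'a" where
  "row_weight q a h (v # vs) (x # xs) =
     (if h \<noteq> v then q * a - 1 else if x = 0 then q - a else if h then (q\<^sup>2 - 1)\<^sup>2 * a / q else 1)
     * row_weight q a (if x = 0 then h else \<not> h) vs xs"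
| "row_weight q a h _ _ = 1"

lemma finite_admissible_rows: "finite (admissible_rows h vs)"
  by (induction vs arbitrary: h) auto

lemma admissible_rows_iff:
  "xs \<in> admissible_rows h vs \<longleftrightarrow> length xs = length vs \<and> asm_line h xs \<and>
     (\<forall>j<length vs. xs ! j = 0 \<or> xs ! j = (if vs ! j then - 1 else 1))"
proof (induction vs arbitrary: h xs)
  case (Cons v vs)
  show ?case
  proof (cases xs)
    case (Cons y ys)
    have "(\<forall>j<length (v # vs). xs ! j = 0 \<or> xs ! j = (if (v # vs) ! j then - 1 else 1)) \<longleftrightarrow>
      (y = 0 \<or> y = (if v then - 1 else 1)) \<and> (\<forall>j<length vs. ys ! j = 0 \<or> ys ! j = (if vs ! j then - 1 else 1))"
      unfolding Cons by (simp add: All_less_Suc2)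
    then show ?thesis using Cons.IH by (auto simp: Cons)
  qed auto
qed auto

lemma length_admissible_rows: "xs \<in> admissible_rows h vs \<Longrightarrow> length xs = length vs"
  by (simp add: admissible_rows_iff)

lemma length_flip_columns [simp]: "length (flip_columns vs xs) = min (length vs) (length xs)"
  by (simp add: flip_columns_def)

lemma row_transfer_sum_admissible_rows:
  "row_transfer q a h (replicate (length vs) 1) vs F =
    (\<Sum>xs\<in>admissible_rows h vs. row_weight q a h vs xs * F (flip_columns vs xs))"
proof (induction vs arbitrary: h F)
  case (Cons v vs)
  let ?Z = "(#) 0 ` admissible_rows h vs"
  let ?c = "if h then - 1 else 1 :: int"
  let ?N = "(#) ?c ` admissible_rows (\<not> h) vs"
  have Z: "(\<Sum>xs\<in>?Z. row_weight q a h (v # vs) xs * F (flip_columns (v # vs) xs)) =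
     (if h = v then q - a else q * a - 1) * row_transfer q a h (replicate (length vs) 1) vs (\<lambda>u. F (v # u))"
    unfolding Cons.IH by (subst sum.reindex) (auto simp: sum_distrib_left mult.assoc)
  have N: "(\<Sum>xs\<in>?N. row_weight q a h (v # vs) xs * F (flip_columns (v # vs) xs)) =
     (if h then (q\<^sup>2 - 1)\<^sup>2 * a / q else 1) * row_transfer q a (\<not> h) (replicate (length vs) 1) vs (\<lambda>u. F ((\<not> v) # u))"
    if "h = v"
    unfolding Cons.IH using that by (subst sum.reindex) (auto simp: sum_distrib_left mult.assoc)
  show ?case
  proof (cases "h = v")
    case True
    have "(\<Sum>xs\<in>?Z \<union> ?N. row_weight q a h (v # vs) xs * F (flip_columns (v # vs) xs)) =
     (\<Sum>xs\<in>?Z. row_weight q a h (v # vs) xs * F (flip_columns (v # vs) xs))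
     + (\<Sum>xs\<in>?N. row_weight q a h (v # vs) xs * F (flip_columns (v # vs) xs))"
      by (intro sum.union_disjoint) (auto simp: finite_admissible_rows)
    then show ?thesis using True unfolding Z N[OF True] by simp
  next
    case False
    then show ?thesis using Z by simp
  qed
qed auto

text \<open>Alternating sign matrices as lists of rows, for arbitrary initial column sums. Only with these is
the set amenable to induction on the number of rows.\<close>

fun grids :: "nat \<Rightarrow> bool list \<Rightarrow> int list list set" where
  "grids 0 vs = (if \<forall>v\<in>set vs. v then {[]} else {})"
| "grids (Suc m) vs = (\<Union>xs\<in>admissible_rows False vs. (#) xs ` grids m (flip_columns vs xs))"

fun grid_weight :: "'a::field \<Rightarrow> 'a list \<Rightarrow> bool list \<Rightarrow> int list list \<Rightarrow> 'a" where
  "grid_weight q (a # as) vs (x # X) = row_weight q a False vs x * grid_weight q as (flip_columns vs x) X"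
| "grid_weight q _ vs _ = 1"

lemma finite_grids: "finite (grids m vs)"
  by (induction m arbitrary: vs) (auto simp: finite_admissible_rows)

lemma dwbc_sum_grids:
  "length vs = n \<Longrightarrow> dwbc q as (replicate n 1) vs = (\<Sum>X\<in>grids (length as) vs. grid_weight q as vs X)"
proof (induction as arbitrary: vs)
  case (Cons a as)
  have "dwbc q (a # as) (replicate n 1) vs = (\<Sum>xs\<in>admissible_rows False vs.
      row_weight q a False vs xs * dwbc q as (replicate n 1) (flip_columns vs xs))"
    using row_transfer_sum_admissible_rows[of q a False vs] Cons.prems by simp
  also have "\<dots> = (\<Sum>xs\<in>admissible_rows False vs. \<Sum>X\<in>(#) xs ` grids (length as) (flip_columns vs xs).
      grid_weight q (a # as) vs X)"
  proof (rule sum.cong[OF refl])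
    fix xs assume "xs \<in> admissible_rows False vs"
    then have "length (flip_columns vs xs) = n" using Cons.prems by (simp add: length_admissible_rows)
    then show "row_weight q a False vs xs * dwbc q as (replicate n 1) (flip_columns vs xs) =
      (\<Sum>X\<in>(#) xs ` grids (length as) (flip_columns vs xs). grid_weight q (a # as) vs X)"
      by (subst sum.reindex) (auto simp: Cons.IH sum_distrib_left)
  qed
  also have "\<dots> = (\<Sum>X\<in>grids (length (a # as)) vs. grid_weight q (a # as) vs X)"
    unfolding length_Cons grids.simps(2)
    by (subst sum.UNION_disjoint) (auto simp: finite_admissible_rows finite_grids)
  finally show ?case .
qed simp

text \<open>The recursive description by rows agrees with the symmetric one, which treats rows and columns alike.\<close>

lemma grids_iff:
  "length vs = n \<Longrightarrow> X \<in> grids m vs \<longleftrightarrow> length X = m \<and> (\<forall>x\<in>set X. length x = n \<and> asm_line False x)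
     \<and> (\<forall>j<n. asm_line (vs ! j) (map (\<lambda>x. x ! j) X))"
proof (induction m arbitrary: vs X)
  case 0
  then show ?case by (cases X) (simp_all add: all_set_conv_all_nth)
next
  case (Suc m)
  show ?case
  proof (cases X)
    case (Cons x Y)
    let ?column = "\<lambda>h j. asm_line h (map (\<lambda>x. x ! j) Y)"
    have row: "x \<in> admissible_rows False vs \<longleftrightarrow> length x = n \<and> asm_line False x
        \<and> (\<forall>j<n. x ! j = 0 \<or> x ! j = (if vs ! j then - 1 else 1))"
      unfolding admissible_rows_iff Suc.prems ..
    have below: "Y \<in> grids m (flip_columns vs x) \<longleftrightarrow> length Y = m
        \<and> (\<forall>x\<in>set Y. length x = n \<and> asm_line False x) \<and> (\<forall>j<n. ?column (vs ! j \<noteq> (x ! j \<noteq> 0)) j)"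
      if "length x = n"
    proof -
      have "flip_columns vs x ! j = (vs ! j \<noteq> (x ! j \<noteq> 0))" if "j < n" for j
        using that \<open>length x = n\<close> Suc.prems by (simp add: flip_columns_def)
      then show ?thesis using Suc.IH[of "flip_columns vs x" Y] Suc.prems that by simp
    qed
    have column: "asm_line (vs ! j) (map (\<lambda>x. x ! j) X) \<longleftrightarrow>
      (x ! j = 0 \<or> x ! j = (if vs ! j then - 1 else 1)) \<and> ?column (vs ! j \<noteq> (x ! j \<noteq> 0)) j" for j
      by (cases "vs ! j"; cases "x ! j = 0") (simp_all add: Cons)
    have "X \<in> grids (Suc m) vs \<longleftrightarrow> x \<in> admissible_rows False vs \<and> Y \<in> grids m (flip_columns vs x)"
      by (auto simp: Cons)
    also have "\<dots> \<longleftrightarrow> length X = Suc m \<and> (\<forall>x\<in>set X. length x = n \<and> asm_line False x)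
     \<and> (\<forall>j<n. asm_line (vs ! j) (map (\<lambda>x. x ! j) X))"
      unfolding column using row below by (simp only: Cons list.set length_Cons) blast
    finally show ?thesis .
  qed auto
qed

definition grid_mat :: "nat \<Rightarrow> int list list \<Rightarrow> int mat" where
  "grid_mat n X = mat n n (\<lambda>(i, j). X ! i ! j)"

lemma list_of_vec_row_grid_mat:
  "length X = n \<Longrightarrow> \<forall>x\<in>set X. length x = n \<Longrightarrow> i < n \<Longrightarrow> list_of_vec (row (grid_mat n X) i) = X ! i"
  by (rule nth_equalityI) (auto simp: grid_mat_def list_of_vec_index)

lemma list_of_vec_col_grid_mat:
  "length X = n \<Longrightarrow> j < n \<Longrightarrow> list_of_vec (col (grid_mat n X) j) = map (\<lambda>x. x ! j) X"
  by (rule nth_equalityI) (auto simp: grid_mat_def list_of_vec_index)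

lemma bij_betw_grids_ASM: "bij_betw (grid_mat n) (grids n (replicate n False)) (ASM n)"
proof (rule bij_betw_byWitness[where f' = "\<lambda>A. map (\<lambda>i. list_of_vec (row A i)) [0..<n]"])
  note iff = grids_iff[of "replicate n False" n, OF length_replicate]
  have inv: "map (\<lambda>i. list_of_vec (row (grid_mat n X) i)) [0..<n] = X"
    if "length X = n" "\<forall>x\<in>set X. length x = n" for X
    using that by (intro nth_equalityI) (auto simp: list_of_vec_row_grid_mat)
  have inv': "grid_mat n (map (\<lambda>i. list_of_vec (row A i)) [0..<n]) = A" if "A \<in> carrier_mat n n" for A
    using that by (intro eq_matI) (auto simp: grid_mat_def list_of_vec_index)
  have len: "length (map (\<lambda>i. list_of_vec (row A i)) [0..<n]) = n"
    "\<forall>x\<in>set (map (\<lambda>i. list_of_vec (row A i)) [0..<n]). length x = n" if "A \<in> carrier_mat n n" for A :: "int mat"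
    using that by auto
  have ASM: "grid_mat n X \<in> ASM n \<longleftrightarrow> X \<in> grids n (replicate n False)"
    if "length X = n" "\<forall>x\<in>set X. length x = n" for X
    unfolding ASM_def alternating_signs_iff_asm_line iff
    using that by (auto simp: list_of_vec_row_grid_mat list_of_vec_col_grid_mat all_set_conv_all_nth)
       (auto simp: grid_mat_def)
  show "\<forall>X\<in>grids n (replicate n False). map (\<lambda>i. list_of_vec (row (grid_mat n X) i)) [0..<n] = X"
    using inv by (auto simp: iff)
  show "\<forall>A\<in>ASM n. grid_mat n (map (\<lambda>i. list_of_vec (row A i)) [0..<n]) = A"
    using inv' by (auto simp: ASM_def)
  show "grid_mat n ` grids n (replicate n False) \<subseteq> ASM n"
    using ASM by (auto simp: iff)
  show "(\<lambda>A. map (\<lambda>i. list_of_vec (row A i)) [0..<n]) ` ASM n \<subseteq> grids n (replicate n False)"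
  proof
    fix X assume "X \<in> (\<lambda>A. map (\<lambda>i. list_of_vec (row A i)) [0..<n]) ` ASM n"
    then obtain A where A: "A \<in> ASM n" "X = map (\<lambda>i. list_of_vec (row A i)) [0..<n]" by auto
    then have c: "A \<in> carrier_mat n n" by (simp add: ASM_def)
    show "X \<in> grids n (replicate n False)"
      using ASM[OF len[OF c]] A inv'[OF c] by simp
  qed
qed

section \<open>The doubly refined generating function\<close>

definition unit_row :: "nat \<Rightarrow> nat \<Rightarrow> int list" where
  "unit_row n p = replicate p 0 @ 1 # replicate (n - 1 - p) 0"

lemma unit_row_simps: "unit_row (Suc n) 0 = 1 # replicate n 0"
  "unit_row (Suc n) (Suc p) = 0 # unit_row n p"
  by (simp_all add: unit_row_def)

lemma admissible_rows_top_True: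
  "xs \<in> admissible_rows True (replicate n False) \<Longrightarrow>
    xs = replicate n 0 \<and> row_weight q a True (replicate n False) xs = (q * a - 1) ^ n"
  by (induction n arbitrary: xs) auto

text \<open>Above the first row all column sums are 0. Before the 1 both the row sum and the column sum are 0,
after it they differ, so the two kinds of weight of a zero entry count the entries before and after
the 1.\<close>

lemma admissible_rows_top:
  "xs \<in> admissible_rows False (replicate n False) \<Longrightarrow> \<exists>p<n. xs = unit_row n p \<and>
     row_weight q a False (replicate n False) xs = (q - a) ^ p * (q * a - 1) ^ (n - 1 - p)"
proof (induction n arbitrary: xs)
  case (Suc n)
  then consider ys where "xs = 0 # ys" "ys \<in> admissible_rows False (replicate n False)"
    | ys where "xs = 1 # ys" "ys \<in> admissible_rows True (replicate n False)" by auto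
  then show ?case
  proof cases
    case 1
    with Suc.IH[of ys] obtain p where "p < n" "ys = unit_row n p"
      "row_weight q a False (replicate n False) ys = (q - a) ^ p * (q * a - 1) ^ (n - 1 - p)" by auto
    with 1 show ?thesis by (intro exI[of _ "Suc p"]) (auto simp: unit_row_simps)
  next
    case 2
    with admissible_rows_top_True[of ys n q a] show ?thesis
      by (intro exI[of _ 0]) (auto simp: unit_row_simps)
  qed
qed simp

lemma admissible_rows_bottom_True:
  "xs \<in> admissible_rows True vs \<Longrightarrow> \<forall>v\<in>set (flip_columns vs xs). v \<Longrightarrow>
    xs = replicate (length vs) 0 \<and> row_weight q a True vs xs = (q - a) ^ length vs"
  by (induction vs arbitrary: xs) (auto split: if_splits)

text \<open>Below the last row all column sums are 1, so the roles of the two weights are interchanged in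
comparison with the first row.\<close>

lemma admissible_rows_bottom:
  "xs \<in> admissible_rows False vs \<Longrightarrow> \<forall>v\<in>set (flip_columns vs xs). v \<Longrightarrow>
   \<exists>p<length vs. xs = unit_row (length vs) p \<and>
     row_weight q a False vs xs = (q * a - 1) ^ p * (q - a) ^ (length vs - 1 - p)"
proof (induction vs arbitrary: xs)
  case (Cons v vs)
  then consider ys where "v" "xs = 0 # ys" "ys \<in> admissible_rows False vs"
    | ys where "\<not> v" "xs = 1 # ys" "ys \<in> admissible_rows True vs" by (auto split: if_splits)
  then show ?case
  proof cases
    case 1
    with Cons.IH[of ys] Cons.prems obtain p where "p < length vs" "ys = unit_row (length vs) p"
      "row_weight q a False vs ys = (q * a - 1) ^ p * (q - a) ^ (length vs - 1 - p)" by auto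
    with 1 show ?thesis by (intro exI[of _ "Suc p"]) (auto simp: unit_row_simps)
  next
    case 2
    with admissible_rows_bottom_True[of ys vs q a] Cons.prems show ?thesis
      by (intro exI[of _ 0]) (auto simp: unit_row_simps)
  qed
qed simp

lemma count_unit_row: "count_list (unit_row n p) (- 1) = 0"
  by (simp add: unit_row_def count_list_0_iff)

text \<open>For equal parameters the weight depends on the number of entries -1 only, because the entries 1
exceed them by one in a full row and both weights of a zero are \<open>q - 1\<close>. The factor on the left
corrects for a row that has been entered with sum 1, where the excess is 0.\<close>

lemma row_weight_homogeneous:
  assumes z: "(q\<^sup>2 - 1)\<^sup>2 / q = (q - 1)\<^sup>2 * z"
  shows "xs \<in> admissible_rows h vs \<Longrightarrow> row_weight q 1 h vs xs * (if h then 1 else q - 1)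
    = (q - 1) ^ length vs * z ^ count_list xs (- 1)"
proof (induction vs arbitrary: h xs)
  case (Cons v vs)
  from Cons.prems consider
      ys where "xs = 0 # ys" "ys \<in> admissible_rows h vs"
    | ys where "h" "v" "xs = - 1 # ys" "ys \<in> admissible_rows False vs"
    | ys where "\<not> h" "\<not> v" "xs = 1 # ys" "ys \<in> admissible_rows True vs"
    by (auto split: if_splits)
  then show ?case
  proof cases
    case 1
    then have "row_weight q 1 h (v # vs) xs = (q - 1) * row_weight q 1 h vs ys" by simp
    then show ?thesis using Cons.IH[OF 1(2)] 1(1) by (simp add: mult.assoc)
  next
    case 2
    then have "row_weight q 1 h (v # vs) xs * (if h then 1 else q - 1)
      = (q - 1) * z * (row_weight q 1 False vs ys * (q - 1))"
      using z by (simp add: power2_eq_square)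
    also have "\<dots> = (q - 1) ^ length (v # vs) * z ^ count_list xs (- 1)"
      using Cons.IH[OF 2(4)] 2 by simp
    finally show ?thesis .
  next
    case 3
    then have "row_weight q 1 h (v # vs) xs = row_weight q 1 True vs ys" by simp
    then show ?thesis using Cons.IH[OF 3(4)] 3 by (simp add: mult.commute mult.assoc)
  qed
qed auto

text \<open>The rows with parameter 1 and the last row: each of the former contributes \<open>(q - 1)\<^sup>n\<^sup>-\<^sup>1\<close> and a factor
\<open>z\<close> for each of its entries -1.\<close>

lemma grid_weight_below_top:
  assumes q: "q \<noteq> 1" and z: "(q\<^sup>2 - 1)\<^sup>2 / q = (q - 1)\<^sup>2 * z"
  shows "X \<in> grids (Suc N) vs \<Longrightarrow> length vs = n \<Longrightarrow> \<exists>p<n. last X = unit_row n p \<and>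
    grid_weight q (replicate N 1 @ [b]) vs X =
      (q - 1) ^ ((n - 1) * N) * z ^ (\<Sum>x\<leftarrow>X. count_list x (- 1))
      * ((q * b - 1) ^ p * (q - b) ^ (n - 1 - p))"
proof (induction N arbitrary: vs X)
  case 0
  then obtain x where x: "X = [x]" "x \<in> admissible_rows False vs" "\<forall>v\<in>set (flip_columns vs x). v"
    by (auto split: if_splits)
  from admissible_rows_bottom[OF x(2,3), of q b] 0 x(1) show ?case
    by (auto simp: count_unit_row)
next
  case (Suc N)
  then obtain x Y where x: "X = x # Y" "x \<in> admissible_rows False vs" "Y \<in> grids (Suc N) (flip_columns vs x)"
    by (auto simp only: grids.simps(2)[of "Suc N"])
  have "length (flip_columns vs x) = n" using x Suc.prems by (simp add: length_admissible_rows)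
  from Suc.IH[OF x(3) this] obtain p where p: "p < n" "last Y = unit_row n p"
    "grid_weight q (replicate N 1 @ [b]) (flip_columns vs x) Y =
      (q - 1) ^ ((n - 1) * N) * z ^ (\<Sum>x\<leftarrow>Y. count_list x (- 1))
      * ((q * b - 1) ^ p * (q - b) ^ (n - 1 - p))" by blast
  have "Y \<noteq> []" using x(3) by auto
  have "n = Suc (n - 1)" using p(1) by simp
  then have "(q - 1) ^ n = (q - 1) ^ (n - 1) * (q - 1)"
    by (metis power_Suc2)
  then have row: "row_weight q 1 False vs x = (q - 1) ^ (n - 1) * z ^ count_list x (- 1)"
    using row_weight_homogeneous[OF z x(2)] q Suc.prems by simp
  have "grid_weight q (replicate (Suc N) 1 @ [b]) vs X
      = row_weight q 1 False vs x * grid_weight q (replicate N 1 @ [b]) (flip_columns vs x) Y"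
    by (simp add: x(1))
  also have "\<dots> = (q - 1) ^ ((n - 1) * Suc N) * z ^ (\<Sum>x\<leftarrow>X. count_list x (- 1))
      * ((q * b - 1) ^ p * (q - b) ^ (n - 1 - p))"
    unfolding row p(3) x(1) mult_Suc_right list.map sum_list.Cons power_add
    by (simp only: ac_simps)
  finally show ?case using p \<open>Y \<noteq> []\<close> x(1) by auto
qed

lemma unit_row_nth: "i < n \<Longrightarrow> p < n \<Longrightarrow> unit_row n p ! i = (if i = p then 1 else 0)"
  by (auto simp: unit_row_def nth_append nth_Cons')

lemma unit_row_position:
  assumes "p < n" shows "(THE j. 1 \<le> j \<and> j \<le> n \<and> unit_row n p ! (j - 1) = 1) = Suc p"
  using assms by (intro the_equality) (auto simp: unit_row_nth split: if_splits)

lemma asm_first_grid_mat: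
  assumes "X ! 0 = unit_row n p" "p < n"
  shows "asm_first (grid_mat n X) = Suc p"
proof -
  have "(1 \<le> j \<and> j \<le> n \<and> grid_mat n X $$ (0, j - 1) = 1) \<longleftrightarrow>
    (1 \<le> j \<and> j \<le> n \<and> unit_row n p ! (j - 1) = 1)" for j
    using assms by (auto simp: grid_mat_def)
  then show ?thesis
    unfolding asm_first_def using unit_row_position[OF assms(2)] by (simp add: grid_mat_def)
qed

lemma asm_last_grid_mat:
  assumes "X ! (n - 1) = unit_row n p" "p < n"
  shows "asm_last (grid_mat n X) = Suc p"
proof -
  have "(1 \<le> j \<and> j \<le> n \<and> grid_mat n X $$ (n - 1, j - 1) = 1) \<longleftrightarrow>
    (1 \<le> j \<and> j \<le> n \<and> unit_row n p ! (j - 1) = 1)" for j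
    using assms by (auto simp: grid_mat_def)
  then show ?thesis
    unfolding asm_last_def using unit_row_position[OF assms(2)] by (simp add: grid_mat_def)
qed

lemma asm_mu_grid_mat:
  assumes "length X = n" "\<forall>x\<in>set X. length x = n"
  shows "asm_mu (grid_mat n X) = (\<Sum>x\<leftarrow>X. count_list x (- 1))"
proof -
  have row: "card {j. j < n \<and> X ! i ! j = - 1} = count_list (X ! i) (- 1)" if "i < n" for i
    using assms that by (auto simp: count_list_eq_length_filter length_filter_conv_card eq_commute
        intro!: arg_cong[where f = card])
  have "{(i, j). i < dim_row (grid_mat n X) \<and> j < dim_col (grid_mat n X) \<and> grid_mat n X $$ (i, j) = - 1}
    = (SIGMA i:{..<n}. {j. j < n \<and> X ! i ! j = - 1})"
    by (auto simp: grid_mat_def)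
  then have "asm_mu (grid_mat n X) = (\<Sum>i<n. card {j. j < n \<and> X ! i ! j = - 1})"
    unfolding asm_mu_def by simp
  also have "\<dots> = (\<Sum>x\<leftarrow>X. count_list x (- 1))"
    using assms(1) row by (simp add: sum.list_conv_set_nth atLeast0LessThan)
  finally show ?thesis .
qed

text \<open>The top parameter is chosen such that the weight of a zero before the 1 is \<open>\<rho>\<close> times that of a
zero after the 1. In the bottom row the ratio is \<open>\<tau>\<close>. The normalisation of \<open>q - 1\<close> to 1 turns the weight of
an entry -1 into \<open>(q\<^sup>2 - 1)\<^sup>2 / (q (q - 1)\<^sup>2) = 2 + q + 1/q\<close>.\<close>

theorem dwbc_boundary_rows:
  fixes q \<rho> \<tau> :: "'a::field"
  assumes n: "n \<ge> 2" and q: "q \<noteq> 0" "q \<noteq> 1" and \<rho>: "1 + \<rho> * q \<noteq> 0" and \<tau>: "\<tau> + q \<noteq> 0"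
  shows "\<rho> * \<tau> * dwbc q (boundary_rows n ((\<rho> + q) / (1 + \<rho> * q)) ((1 + \<tau> * q) / (\<tau> + q)))
      (replicate n 1) (replicate n False) =
    (((q\<^sup>2 - 1) / (1 + \<rho> * q)) * ((q\<^sup>2 - 1) / (\<tau> + q))) ^ (n - 1) * (q - 1) ^ ((n - 1) * (n - 2))
    * asm_gf n (2 + q + inverse q) \<rho> \<tau>"
proof -
  define \<alpha> \<beta> where "\<alpha> = (\<rho> + q) / (1 + \<rho> * q)" and "\<beta> = (1 + \<tau> * q) / (\<tau> + q)"
  define k l where "k = (q\<^sup>2 - 1) / (1 + \<rho> * q)" and "l = (q\<^sup>2 - 1) / (\<tau> + q)"
  define C where "C = (k * l) ^ (n - 1) * (q - 1) ^ ((n - 1) * (n - 2))"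
  have ab: "q - \<alpha> = \<rho> * k" "q * \<alpha> - 1 = k" "q * \<beta> - 1 = \<tau> * l" "q - \<beta> = l"
    unfolding \<alpha>_def \<beta>_def k_def l_def using \<rho> \<tau> by (simp_all add: field_simps power2_eq_square)
  have pw: "(c * x) ^ p * x ^ (n - 1 - p) = c ^ p * x ^ (n - 1)" if "p < n" for c x :: 'a and p
    using that by (simp add: power_mult_distrib mult.assoc flip: power_add)
  have z: "(q\<^sup>2 - 1)\<^sup>2 / q = (q - 1)\<^sup>2 * (2 + q + inverse q)"
    using q by (simp add: field_simps power2_eq_square)
  have weight: "\<rho> * \<tau> * grid_weight q (boundary_rows n \<alpha> \<beta>) (replicate n False) X =
      C * ((2 + q + inverse q) ^ asm_mu (grid_mat n X) * \<rho> ^ asm_first (grid_mat n X) * \<tau> ^ asm_last (grid_mat n X))"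
    if X: "X \<in> grids n (replicate n False)" for X
  proof -
    define N where "N = n - 2"
    have N: "n = Suc (n - 1)" "n - 1 = Suc N" "n - 2 = N" using n by (auto simp: N_def)
    from X have "X \<in> grids (Suc (n - 1)) (replicate n False)" using N(1) by metis
    then have "X \<in> grids (Suc (Suc N)) (replicate n False)" by (simp only: N(2))
    then obtain x Y where x: "X = x # Y" "x \<in> admissible_rows False (replicate n False)"
      "Y \<in> grids (Suc N) (flip_columns (replicate n False) x)"
      by (auto simp only: grids.simps(2)[of "Suc N"])
    have "length (flip_columns (replicate n False) x) = n" using x by (simp add: length_admissible_rows)
    from grid_weight_below_top[OF q(2) z x(3) this, of \<beta>] obtain r where r: "r < n" "last Y = unit_row n r"
      "grid_weight q (replicate N 1 @ [\<beta>]) (flip_columns (replicate n False) x) Y =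
      (q - 1) ^ ((n - 1) * N) * (2 + q + inverse q) ^ (\<Sum>x\<leftarrow>Y. count_list x (- 1))
      * ((q * \<beta> - 1) ^ r * (q - \<beta>) ^ (n - 1 - r))" by blast
    from admissible_rows_top[OF x(2), of q \<alpha>] obtain p where p: "p < n" "x = unit_row n p"
      "row_weight q \<alpha> False (replicate n False) x = (q - \<alpha>) ^ p * (q * \<alpha> - 1) ^ (n - 1 - p)" by blast
    have len: "length X = n" "\<forall>x\<in>set X. length x = n"
      using X grids_iff[of "replicate n False" n X n] by auto
    have "X ! (n - 1) = unit_row n r"
    proof -
      have "Y \<noteq> []" using x(3) by auto
      then have "last X = X ! (n - 1)" "last X = last Y"
        using len(1) x(1) by (auto simp: last_conv_nth)
      then show ?thesis using r(2) by simp
    qed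
    then have l: "asm_last (grid_mat n X) = Suc r" using r(1) by (rule asm_last_grid_mat)
    have f: "asm_first (grid_mat n X) = Suc p"
      using p(1,2) x(1) by (intro asm_first_grid_mat) auto
    have m: "asm_mu (grid_mat n X) = (\<Sum>x\<leftarrow>Y. count_list x (- 1))"
      unfolding asm_mu_grid_mat[OF len] by (simp add: x(1) p(2) count_unit_row)
    have "grid_weight q (boundary_rows n \<alpha> \<beta>) (replicate n False) X =
      row_weight q \<alpha> False (replicate n False) x *
      grid_weight q (replicate N 1 @ [\<beta>]) (flip_columns (replicate n False) x) Y"
      by (simp add: boundary_rows_def x(1) N(3))
    also have "\<dots> = C * ((2 + q + inverse q) ^ (\<Sum>x\<leftarrow>Y. count_list x (- 1)) * \<rho> ^ p * \<tau> ^ r)"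
      unfolding r(3) p(3) ab pw[OF p(1)] pw[OF r(1)]
      unfolding C_def N(3) power_mult_distrib
      by (simp only: ac_simps)
    finally show ?thesis unfolding l f m power_Suc by (simp only: ac_simps)
  qed
  have "length (boundary_rows n \<alpha> \<beta>) = n" using n by (simp add: boundary_rows_def)
  then have "\<rho> * \<tau> * dwbc q (boundary_rows n \<alpha> \<beta>) (replicate n 1) (replicate n False) =
    (\<Sum>X\<in>grids n (replicate n False). \<rho> * \<tau> * grid_weight q (boundary_rows n \<alpha> \<beta>) (replicate n False) X)"
    using dwbc_sum_grids[of "replicate n False" n q "boundary_rows n \<alpha> \<beta>"] by (simp add: sum_distrib_left)
  also have "\<dots> = C * (\<Sum>X\<in>grids n (replicate n False). (2 + q + inverse q) ^ asm_mu (grid_mat n X)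
       * \<rho> ^ asm_first (grid_mat n X) * \<tau> ^ asm_last (grid_mat n X))"
    unfolding sum_distrib_left by (rule sum.cong[OF refl weight])
  also have "\<dots> = C * asm_gf n (2 + q + inverse q) \<rho> \<tau>"
    unfolding asm_gf_def by (subst sum.reindex_bij_betw[OF bij_betw_grids_ASM]) simp
  finally show ?thesis unfolding \<alpha>_def \<beta>_def C_def k_def l_def .
qed

text \<open>The identity for values in an arbitrary infinite field at which no denominator vanishes. The signs and
powers of \<open>q\<close> from the determinant formula are absorbed by \<open>2 - q - 1/q = - (q - 1)\<^sup>2 / q\<close>.\<close>

theorem asm_gf_eq_det_K_mat:
  fixes q \<rho> \<tau> :: "'a::field"
  assumes inf: "infinite (UNIV :: 'a set)" and n: "n \<ge> 2"
    and q: "q \<noteq> 0" "q \<noteq> 1" "q \<noteq> - 1" and \<rho>: "1 + \<rho> * q \<noteq> 0" and \<tau>: "\<tau> + q \<noteq> 0"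
  shows "asm_gf n (2 + q + inverse q) \<rho> \<tau> =
    (((1 + \<rho> * q) * (\<tau> + q)) / (1 + q)\<^sup>2) ^ (n - 1)
    * ((\<tau> * \<rho> * det (K_mat n q \<rho> \<tau>)) / (2 - q - inverse q) ^ (n * (n - 1) div 2))"
proof -
  define Z where "Z = dwbc q (boundary_rows n ((\<rho> + q) / (1 + \<rho> * q)) ((1 + \<tau> * q) / (\<tau> + q)))
      (replicate n 1) (replicate n False)"
  define G where "G = asm_gf n (2 + q + inverse q) \<rho> \<tau>"
  define N2 where "N2 = n * (n - 1) div 2"
  have q2: "q\<^sup>2 \<noteq> 1" using q by (simp add: power2_eq_1_iff)
  have q1: "q - 1 \<noteq> 0" "1 + q \<noteq> 0" using q by (auto simp: add_eq_0_iff)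
  have "det (K_mat n q \<rho> \<tau>) = (\<Prod>i<n. (- 1 / q) ^ i) * Z"
    unfolding K_mat_eq_dw_newton[OF n] Z_def
    using n by (intro det_dw_newton_eq_dwbc[OF inf q(1) q2]) (auto simp: boundary_rows_def)
  also have "(\<Prod>i<n. (- 1 / q) ^ i) = (- 1 / q) ^ N2"
    unfolding N2_def by (simp add: power_sum[symmetric] Sum_Ico_nat flip: atLeast0LessThan)
  finally have K: "det (K_mat n q \<rho> \<tau>) = (- 1 / q) ^ N2 * Z" .
  have "2 - q - inverse q = (- 1 / q) * (q - 1)\<^sup>2" using q(1) by (simp add: field_simps power2_eq_square)
  moreover have "2 * N2 = n * (n - 1)"
    unfolding N2_def by (rule dvd_mult_div_cancel) (cases n; simp)
  ultimately have D: "(2 - q - inverse q) ^ N2 = (- 1 / q) ^ N2 * (q - 1) ^ (n * (n - 1))"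
    by (simp only: power_mult_distrib flip: power_mult)
  have Z: "\<rho> * \<tau> * Z = (((q\<^sup>2 - 1) / (1 + \<rho> * q)) * ((q\<^sup>2 - 1) / (\<tau> + q))) ^ (n - 1)
      * (q - 1) ^ ((n - 1) * (n - 2)) * G"
    unfolding Z_def G_def by (rule dwbc_boundary_rows[OF n q(1,2) \<rho> \<tau>])
  have "n * (n - 1) = 2 * (n - 1) + (n - 1) * (n - 2)"
    using n by (cases n) (auto simp: algebra_simps diff_mult_distrib2 numeral_2_eq_2)
  then have e: "(q - 1) ^ (n * (n - 1)) = ((q - 1)\<^sup>2) ^ (n - 1) * (q - 1) ^ ((n - 1) * (n - 2))"
    by (simp add: power_add power_mult)
  have f: "((1 + \<rho> * q) * (\<tau> + q) / (1 + q)\<^sup>2) * (((q\<^sup>2 - 1) / (1 + \<rho> * q)) * ((q\<^sup>2 - 1) / (\<tau> + q))) = (q - 1)\<^sup>2"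
  proof -
    have "q\<^sup>2 - 1 = (q - 1) * (1 + q)" by (simp add: power2_eq_square algebra_simps)
    then show ?thesis using \<rho> \<tau> q1 by (simp add: power2_eq_square)
  qed
  have "((1 + \<rho> * q) * (\<tau> + q) / (1 + q)\<^sup>2) ^ (n - 1) * (\<tau> * \<rho> * det (K_mat n q \<rho> \<tau>) / (2 - q - inverse q) ^ N2)
     = ((1 + \<rho> * q) * (\<tau> + q) / (1 + q)\<^sup>2) ^ (n - 1) * (\<rho> * \<tau> * Z) / (q - 1) ^ (n * (n - 1))"
    unfolding K D using q(1) by simp
  also have "\<dots> = (((1 + \<rho> * q) * (\<tau> + q) / (1 + q)\<^sup>2) * (((q\<^sup>2 - 1) / (1 + \<rho> * q)) * ((q\<^sup>2 - 1) / (\<tau> + q)))) ^ (n - 1)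
     * (q - 1) ^ ((n - 1) * (n - 2)) * G / (q - 1) ^ (n * (n - 1))"
    unfolding Z power_mult_distrib by (simp only: mult.assoc)
  also have "\<dots> = G" unfolding f e using q1 by simp
  finally show ?thesis unfolding G_def N2_def by simp
qed

theorem theorem1p1:
  fixes n :: nat and q \<rho> \<tau> :: "'a::field_char_0 ratfun3"
  assumes "n \<ge> 2"
    and "q = q_var" and "\<rho> = rho_var" and "\<tau> = tau_var"
  shows "asm_gf n (2 + q + inverse q) \<rho> \<tau> =
    (((1 + \<rho> * q) * (\<tau> + q)) / (1 + q)\<^sup>2) ^ (n - 1)
    * ((\<tau> * \<rho> * det (K_mat n q \<rho> \<tau>)) / (2 - q - inverse q) ^ (n * (n - 1) div 2))"
proof (rule asm_gf_eq_det_K_mat[OF _ assms(1)])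
  have "inj (to_fract :: 'a poly poly poly \<Rightarrow> 'a ratfun3)" by (simp add: inj_on_def)
  moreover have "infinite (UNIV :: 'a poly poly poly set)" by (rule infinite_UNIV_char_0)
  ultimately have "infinite (range (to_fract :: 'a poly poly poly \<Rightarrow> 'a ratfun3))"
    by (simp add: finite_image_iff)
  then show "infinite (UNIV :: 'a ratfun3 set)" by (rule infinite_super[OF subset_UNIV])
  have nonzero: "to_fract p \<noteq> (0 :: 'a ratfun3)" if "p \<noteq> 0" for p
    using that by simp
  have "q = to_fract [:[:[:0, 1:]:]:]" unfolding assms q_var_def ..
  with nonzero[of "[:[:[:0, 1:]:]:]"] show "q \<noteq> 0" by simp
  have "q - 1 = to_fract ([:[:[:0, 1:]:]:] - 1)"
    unfolding assms q_var_def by simp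
  moreover have "[:[:[:0, 1:]:]:] - 1 \<noteq> (0 :: 'a poly poly poly)"
    by (simp add: one_pCons)
  ultimately have "q - 1 \<noteq> 0" by (simp only: nonzero not_False_eq_True)
  then show "q \<noteq> 1" by simp
  have "q + 1 = to_fract ([:[:[:0, 1:]:]:] + 1)"
    unfolding assms q_var_def by simp
  moreover have "[:[:[:0, 1:]:]:] + 1 \<noteq> (0 :: 'a poly poly poly)"
    by (simp add: one_pCons)
  ultimately have "q + 1 \<noteq> 0" by (simp only: nonzero not_False_eq_True)
  then show "q \<noteq> - 1" by (simp add: eq_neg_iff_add_eq_0)
  have "1 + \<rho> * q = to_fract (1 + [:[:0, 1:]:] * [:[:[:0, 1:]:]:])"
    unfolding assms q_var_def rho_var_def by (simp only: to_fract_add to_fract_mult to_fract_1)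
  moreover have "1 + [:[:0, 1:]:] * [:[:[:0, 1:]:]:] \<noteq> (0 :: 'a poly poly poly)"
    by (simp add: one_pCons)
  ultimately show "1 + \<rho> * q \<noteq> 0" by (simp only: nonzero not_False_eq_True)
  have "\<tau> + q = to_fract ([:0, 1:] + [:[:[:0, 1:]:]:])"
    unfolding assms q_var_def tau_var_def by (simp only: to_fract_add)
  moreover have "[:0, 1:] + [:[:[:0, 1:]:]:] \<noteq> (0 :: 'a poly poly poly)" by simp
  ultimately show "\<tau> + q \<noteq> 0" by (simp only: nonzero not_False_eq_True)
qed

end
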